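(* Let $d\ge 2$, $\alpha\in[1,\infty)$ and let $\Omega\subseteq\mathbb R^d$ be an open set. (i) If $f\in W^{1,1}_{\mathcal H_\alpha}(\Omega)$, then $$\|\nabla_{\mathcal H_\alpha}f\|(\Omega)=\int_\Omega|\nabla_{\mathcal H_\alpha}f(x)|\,dx .$$ (ii) The $\alpha$-Hermite variation is lower semicontinuous: if $f,f_k\in\mathcal{BV}_{\mathcal H_\alpha}(\Omega)$, $k\in\mathbb N$, satisfy $f_k\to f$ in $L^1_{\mathrm{loc}}(\Omega)$, then $$\liminf_{k\to\infty}\|\nabla_{\mathcal H_\alpha}f_k\|(\Omega)\ge\|\nabla_{\mathcal H_\alpha}f\|(\Omega).$$
   Context: For $i=1,\dots,d$ put $A^{\pm}_{i,\alpha}=\partial_{x_i}\pm\sqrt{\alpha-1}\,x_i|x|^{(\alpha-2)/2}$ (the second term acting by multiplication). The generalized gradient is $\nabla_{\mathcal H_\alpha}f=(A^-_{d,\alpha}f,\dots,A^-_{1,\alpha}f,A^+_{1,\alpha}f,\dots,A^+_{d,\alpha}f)$. For $\varphi=(\varphi_1,\dots,\varphi_{2d})\in C^1(\Omega;\mathbb R^{2d})$, $$\mathrm{div}_{\mathcal H_\alpha}\varphi=A^+_{d,\alpha}\varphi_1+\cdots+A^+_{1,\alpha}\varphi_d+A^-_{1,\alpha}\varphi_{d+1}+\cdots+A^-_{d,\alpha}\varphi_{2d}.$$ $\mathcal F(\Omega)$ is the class of $\varphi\in C^1_c(\Omega;\mathbb R^{2d})$ with $\sup_{x\in\Omega}(|\varphi_1(x)|^2+\cdots+|\varphi_{2d}(x)|^2)^{1/2}\le1$.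 The $\alpha$-Hermite variation of $f\in L^1(\Omega)$ is $\|\nabla_{\mathcal H_\alpha}f\|(\Omega)=\sup_{\varphi\in\mathcal F(\Omega)}\int_\Omega f\,\mathrm{div}_{\mathcal H_\alpha}\varphi\,dx$, and $\mathcal{BV}_{\mathcal H_\alpha}(\Omega)$ is the set of $f\in L^1(\Omega)$ with $\|\nabla_{\mathcal H_\alpha}f\|(\Omega)<\infty$. $W^{1,1}_{\mathcal H_\alpha}(\Omega)$ is the set of $f\in L^1(\Omega)$ such that $A^{\pm}_{j,\alpha}f\in L^1(\Omega)$ for $1\le j\le d$ (derivatives in the weak sense). *)

theory Defs
  imports "HOL-Analysis.Analysis"
begin

text \<open>
  Euclidean space \<open>\<real>\<^sup>d\<close> is \<^typ>\<open>real ^ 'n\<close> with \<open>d = CARD('n)\<close>. A function on an open set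
  \<open>\<Omega>\<close> is a total function of which only the values on \<open>\<Omega>\<close> matter; elements of \<open>L\<^sup>1(\<Omega>)\<close> are
  represented by functions rather than by classes of functions.
\<close>

definition partial_deriv :: "'n::finite \<Rightarrow> (real ^ 'n \<Rightarrow> real) \<Rightarrow> real ^ 'n \<Rightarrow> real" where
  "partial_deriv i u x = deriv (\<lambda>t. u (x + t *\<^sub>R axis i 1)) 0"

text \<open>\<open>C\<^sup>k\<close> regularity on an open set \<open>\<Omega>\<close>.\<close>

primrec Ck_on :: "nat \<Rightarrow> (real ^ 'n::finite) set \<Rightarrow> (real ^ 'n \<Rightarrow> real) \<Rightarrow> bool" where
  "Ck_on 0 \<Omega> u \<longleftrightarrow> continuous_on \<Omega> u"
| "Ck_on (Suc k) \<Omega> u \<longleftrightarrow>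
     (\<forall>x\<in>\<Omega>. u differentiable (at x)) \<and> (\<forall>i. Ck_on k \<Omega> (partial_deriv i u))"

definition compactly_supported_in :: "'a::topological_space set \<Rightarrow> ('a \<Rightarrow> 'b::zero) \<Rightarrow> bool" where
  "compactly_supported_in \<Omega> u \<longleftrightarrow>
     compact (closure {x \<in> \<Omega>. u x \<noteq> 0}) \<and> closure {x \<in> \<Omega>. u x \<noteq> 0} \<subseteq> \<Omega>"

definition test_functions :: "(real ^ 'n::finite) set \<Rightarrow> (real ^ 'n \<Rightarrow> real) set" where
  "test_functions \<Omega> = {u. (\<forall>k. Ck_on k \<Omega> u) \<and> compactly_supported_in \<Omega> u}"

definition C1c_fields :: "(real ^ 'n::finite) set \<Rightarrow> (real ^ 'n \<Rightarrow> real ^ 'm::finite) set" where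
  "C1c_fields \<Omega> = {\<phi>. (\<forall>j. Ck_on 1 \<Omega> (\<lambda>x. \<phi> x $ j)) \<and> compactly_supported_in \<Omega> \<phi>}"

definition L1_set :: "(real ^ 'n::finite) set \<Rightarrow> (real ^ 'n \<Rightarrow> real) set" where
  "L1_set \<Omega> = {f. set_integrable lebesgue \<Omega> f}"

definition L1loc_set :: "(real ^ 'n::finite) set \<Rightarrow> (real ^ 'n \<Rightarrow> real) set" where
  "L1loc_set \<Omega> = {f. \<forall>K. compact K \<and> K \<subseteq> \<Omega> \<longrightarrow> set_integrable lebesgue K f}"

definition tendsto_L1loc ::
  "(real ^ 'n::finite) set \<Rightarrow> (nat \<Rightarrow> real ^ 'n \<Rightarrow> real) \<Rightarrow> (real ^ 'n \<Rightarrow> real) \<Rightarrow> bool" where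
  "tendsto_L1loc \<Omega> fs f \<longleftrightarrow>
     (\<forall>K. compact K \<and> K \<subseteq> \<Omega> \<longrightarrow> (\<lambda>k. LINT x:K|lebesgue. \<bar>fs k x - f x\<bar>) \<longlonglongrightarrow> 0)"

definition is_weak_partial ::
  "(real ^ 'n::finite) set \<Rightarrow> 'n \<Rightarrow> (real ^ 'n \<Rightarrow> real) \<Rightarrow> (real ^ 'n \<Rightarrow> real) \<Rightarrow> bool" where
  "is_weak_partial \<Omega> i f g \<longleftrightarrow> g \<in> L1loc_set \<Omega> \<and>
     (\<forall>u\<in>test_functions \<Omega>.
        (LINT x:\<Omega>|lebesgue. f x * partial_deriv i u x) = - (LINT x:\<Omega>|lebesgue. g x * u x))"

text \<open>Weak derivatives are unique up to null sets; this picks one representative.\<close>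

definition weak_partial ::
  "(real ^ 'n::finite) set \<Rightarrow> 'n \<Rightarrow> (real ^ 'n \<Rightarrow> real) \<Rightarrow> real ^ 'n \<Rightarrow> real" where
  "weak_partial \<Omega> i f = (SOME g. is_weak_partial \<Omega> i f g)"

text \<open>
  For \<open>\<alpha> < 2\<close> the power is singular at the origin, but the product extends continuously by \<open>0\<close>
  there; this is the value given by the convention \<open>0 powr a = 0\<close>.
\<close>

definition hermite_coeff :: "real \<Rightarrow> 'n::finite \<Rightarrow> real ^ 'n \<Rightarrow> real" where
  "hermite_coeff \<alpha> i x = sqrt (\<alpha> - 1) * (x $ i) * norm x powr ((\<alpha> - 2) / 2)"

definition A_plus :: "real \<Rightarrow> 'n::finite \<Rightarrow> (real ^ 'n \<Rightarrow> real) \<Rightarrow> real ^ 'n \<Rightarrow> real" where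
  "A_plus \<alpha> i u x = partial_deriv i u x + hermite_coeff \<alpha> i x * u x"

definition A_minus :: "real \<Rightarrow> 'n::finite \<Rightarrow> (real ^ 'n \<Rightarrow> real) \<Rightarrow> real ^ 'n \<Rightarrow> real" where
  "A_minus \<alpha> i u x = partial_deriv i u x - hermite_coeff \<alpha> i x * u x"

definition weak_A_plus ::
  "real \<Rightarrow> (real ^ 'n::finite) set \<Rightarrow> 'n \<Rightarrow> (real ^ 'n \<Rightarrow> real) \<Rightarrow> real ^ 'n \<Rightarrow> real" where
  "weak_A_plus \<alpha> \<Omega> i f x = weak_partial \<Omega> i f x + hermite_coeff \<alpha> i x * f x"

definition weak_A_minus ::
  "real \<Rightarrow> (real ^ 'n::finite) set \<Rightarrow> 'n \<Rightarrow> (real ^ 'n \<Rightarrow> real) \<Rightarrow> real ^ 'n \<Rightarrow> real" where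
  "weak_A_minus \<alpha> \<Omega> i f x = weak_partial \<Omega> i f x - hermite_coeff \<alpha> i x * f x"

text \<open>
  The coordinates of \<open>\<real>\<^sup>2\<^sup>d\<close> are indexed by \<^typ>\<open>'n + 'n\<close>. Compared with the ordering
  \<open>(A\<^sup>-\<^sub>d, \<dots>, A\<^sup>-\<^sub>1, A\<^sup>+\<^sub>1, \<dots>, A\<^sup>+\<^sub>d)\<close>, the index \<open>Inl i\<close> is the position \<open>d + 1 - i\<close> (where
  \<open>A\<^sup>-\<^sub>i\<close> stands) and \<open>Inr i\<close> is the position \<open>d + i\<close> (where \<open>A\<^sup>+\<^sub>i\<close> stands). In the divergence the
  signs are exchanged, so that it is minus the formal adjoint of the gradient.
\<close>

definition hermite_grad ::
  "real \<Rightarrow> (real ^ 'n::finite) set \<Rightarrow> (real ^ 'n \<Rightarrow> real) \<Rightarrow> real ^ 'n \<Rightarrow> real ^ ('n + 'n)" where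
  "hermite_grad \<alpha> \<Omega> f x =
     (\<chi> k. case k of Inl i \<Rightarrow> weak_A_minus \<alpha> \<Omega> i f x | Inr i \<Rightarrow> weak_A_plus \<alpha> \<Omega> i f x)"

definition hermite_div ::
  "real \<Rightarrow> (real ^ 'n::finite \<Rightarrow> real ^ ('n + 'n)) \<Rightarrow> real ^ 'n \<Rightarrow> real" where
  "hermite_div \<alpha> \<phi> x =
     (\<Sum>i\<in>UNIV. A_plus \<alpha> i (\<lambda>y. \<phi> y $ Inl i) x) + (\<Sum>i\<in>UNIV. A_minus \<alpha> i (\<lambda>y. \<phi> y $ Inr i) x)"

definition admissible_fields ::
  "(real ^ 'n::finite) set \<Rightarrow> (real ^ 'n \<Rightarrow> real ^ ('n + 'n)) set" where
  "admissible_fields \<Omega> = {\<phi> \<in> C1c_fields \<Omega>. \<forall>x\<in>\<Omega>. norm (\<phi> x) \<le> 1}"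

definition hermite_variation ::
  "real \<Rightarrow> (real ^ 'n::finite) set \<Rightarrow> (real ^ 'n \<Rightarrow> real) \<Rightarrow> ereal" where
  "hermite_variation \<alpha> \<Omega> f =
     (SUP \<phi>\<in>admissible_fields \<Omega>. ereal (LINT x:\<Omega>|lebesgue. f x * hermite_div \<alpha> \<phi> x))"

definition BV_hermite :: "real \<Rightarrow> (real ^ 'n::finite) set \<Rightarrow> (real ^ 'n \<Rightarrow> real) set" where
  "BV_hermite \<alpha> \<Omega> = {f \<in> L1_set \<Omega>. hermite_variation \<alpha> \<Omega> f < \<infinity>}"

definition W11_hermite :: "real \<Rightarrow> (real ^ 'n::finite) set \<Rightarrow> (real ^ 'n \<Rightarrow> real) set" where
  "W11_hermite \<alpha> \<Omega> = {f \<in> L1_set \<Omega>. \<forall>j. (\<exists>g. is_weak_partial \<Omega> j f g) \<and>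
     weak_A_plus \<alpha> \<Omega> j f \<in> L1_set \<Omega> \<and> weak_A_minus \<alpha> \<Omega> j f \<in> L1_set \<Omega>}"

end

theory Submission
  imports Defs
begin

text \<open>
  Write \<open>G\<close> for the Hermite gradient of \<open>f\<close>.

  For a Sobolev function \<open>f\<close>, integration by parts turns the integral of \<open>f\<close> times the divergence of a
  \<open>C\<^sup>1\<close> field \<open>\<phi>\<close> with compact support into the integral of \<open>\<phi> \<bullet> (- G)\<close> (\<open>integral_hermite_div\<close>): the
  divergence is minus the formal adjoint of the gradient. The variation of \<open>f\<close> is thus the supremum of
  these integrals over fields of norm at most \<open>1\<close>, and that supremum is the integral of \<open>norm G\<close>
  (\<open>SUP_integral_inner_eq_integral_norm\<close>). It cannot be larger by the Cauchy-Schwarz inequality, and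
  it is approached by \<open>C\<^sup>1\<close> approximations to the measurable field \<open>- sgn G\<close>.

  Both steps rest on one density theorem, \<open>test_functions_dense_C1\<close>: continuous functions with compact
  support are uniform limits of smooth test functions, with uniform convergence of the first
  derivatives if the function is \<open>C\<^sup>1\<close>. The first step needs it because weak derivatives are
  defined by smooth test functions but the fields are only \<open>C\<^sup>1\<close>; the second because measurability
  provides continuous approximations of \<open>sgn G\<close> and these have to be made \<open>C\<^sup>1\<close>. The theorem is proved
  by mollification, with bumps built from \<open>exp (- 1 / t)\<close>.

  Lower semicontinuity is soft: the divergence of a \<open>C\<^sup>1\<close> field with compact support is bounded and
  vanishes outside a compact subset of \<open>\<Omega>\<close>, so for each field the integral is continuous for
  local \<open>L\<^sup>1\<close> convergence, and the variation is a supremum of such integrals. Boundedness of the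
  divergence uses that the coefficients \<open>sqrt (\<alpha> - 1) x\<^sub>i |x| powr ((\<alpha> - 2) / 2)\<close> extend continuously
  to the origin for \<open>\<alpha> \<ge> 1\<close>.
\<close>

section \<open>Partial derivatives and \<open>C\<^sup>k\<close> functions\<close>

lemma partial_deriv_eq:
  fixes u :: "real ^ 'n::finite \<Rightarrow> real"
  assumes "(u has_derivative D) (at x)"
  shows "partial_deriv i u x = D (axis i 1)"
proof -
  have u: "(u has_derivative D) (at (x + 0 *\<^sub>R axis i 1))" using assms by simp
  have "((\<lambda>t::real. x + t *\<^sub>R axis i 1) has_derivative (\<lambda>t. t *\<^sub>R axis i 1)) (at 0)"
    by (auto intro!: derivative_eq_intros)
  from has_derivative_compose[OF this u]
  have "((\<lambda>t. u (x + t *\<^sub>R axis i 1)) has_derivative (\<lambda>t. D (t *\<^sub>R axis i 1))) (at 0)" .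
  moreover have "(\<lambda>t. D (t *\<^sub>R axis i 1)) = (*) (D (axis i 1))"
    using linear_scale[OF has_derivative_linear[OF assms]] by (auto simp: fun_eq_iff)
  ultimately show ?thesis
    unfolding partial_deriv_def by (intro DERIV_imp_deriv) (simp add: has_field_derivative_def)
qed

text \<open>
This rewrites the Frechet derivative in terms of the partial derivatives, so that continuity of
the partial derivatives gives continuity of the derivative as a linear map. Differentiation under
the integral sign needs it in that form.
\<close>

lemma has_derivative_partial_deriv:
  fixes u :: "real ^ 'n::finite \<Rightarrow> real"
  assumes "u differentiable (at x)"
  shows "(u has_derivative (\<lambda>h. \<Sum>i\<in>UNIV. partial_deriv i u x * h $ i)) (at x)"
proof -
  from assms obtain D where D: "(u has_derivative D) (at x)" by (auto simp: differentiable_def)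
  have "D = (\<lambda>h. \<Sum>i\<in>UNIV. partial_deriv i u x * h $ i)"
  proof
    fix h :: "real ^ 'n"
    have "D h = D (\<Sum>i\<in>UNIV. h $ i *\<^sub>R axis i 1)"
      by (rule arg_cong[where f = D]) (simp add: basis_expansion flip: scalar_mult_eq_scaleR)
    also have "\<dots> = (\<Sum>i\<in>UNIV. h $ i * D (axis i 1))"
      using has_derivative_linear[OF D] by (simp add: linear_sum linear_scale)
    finally show "D h = (\<Sum>i\<in>UNIV. partial_deriv i u x * h $ i)"
      by (simp add: partial_deriv_eq[OF D] mult.commute)
  qed
  then show ?thesis using D by simp
qed

lemma partial_deriv_transform:
  fixes u v :: "real ^ 'n::finite \<Rightarrow> real"
  assumes "open S" "x \<in> S" "\<And>y. y \<in> S \<Longrightarrow> u y = v y" "u differentiable (at x)"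
  shows "v differentiable (at x)" "partial_deriv i v x = partial_deriv i u x"
proof -
  from assms(4) obtain D where D: "(u has_derivative D) (at x)" by (auto simp: differentiable_def)
  have D': "(v has_derivative D) (at x)"
    by (rule has_derivative_transform_within_open[OF D assms(1,2)]) (simp add: assms(3))
  then show "v differentiable (at x)" by (auto simp: differentiable_def)
  show "partial_deriv i v x = partial_deriv i u x"
    using partial_deriv_eq[OF D, of i] partial_deriv_eq[OF D', of i] by simp
qed

lemma partial_deriv_add:
  fixes u v :: "real ^ 'n::finite \<Rightarrow> real"
  assumes "u differentiable (at x)" "v differentiable (at x)"
  shows "partial_deriv i (\<lambda>x. u x + v x) x = partial_deriv i u x + partial_deriv i v x"
proof -
  from assms obtain D E where "(u has_derivative D) (at x)" "(v has_derivative E) (at x)"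
    by (auto simp: differentiable_def)
  from partial_deriv_eq[OF has_derivative_add[OF this]] partial_deriv_eq[OF this(1)]
    partial_deriv_eq[OF this(2)] show ?thesis by simp
qed

lemma partial_deriv_mult:
  fixes u v :: "real ^ 'n::finite \<Rightarrow> real"
  assumes "u differentiable (at x)" "v differentiable (at x)"
  shows "partial_deriv i (\<lambda>x. u x * v x) x = u x * partial_deriv i v x + partial_deriv i u x * v x"
proof -
  from assms obtain D E where "(u has_derivative D) (at x)" "(v has_derivative E) (at x)"
    by (auto simp: differentiable_def)
  from partial_deriv_eq[OF has_derivative_mult[OF this]] partial_deriv_eq[OF this(1)]
    partial_deriv_eq[OF this(2)] show ?thesis by simp
qed

lemma partial_deriv_const: "partial_deriv i (\<lambda>x. c) x = 0"
  by (rule partial_deriv_eq[OF has_derivative_const])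

lemma partial_deriv_eq_0:
  fixes u :: "real ^ 'n::finite \<Rightarrow> real"
  assumes "open S" "x \<in> S" "\<And>y. y \<in> S \<Longrightarrow> u y = 0"
  shows "partial_deriv i u x = 0"
  using partial_deriv_transform(2)[OF assms(1,2), of "\<lambda>x. 0" u i] assms(3)
  by (simp add: partial_deriv_const)

lemma partial_deriv_nth: "partial_deriv i (\<lambda>x. x $ j) x = (if i = j then 1 else 0)"
  by (rule trans[OF partial_deriv_eq[OF bounded_linear_imp_has_derivative[OF bounded_linear_vec_nth]]])
     (simp add: axis_def)

lemma Ck_on_continuous: "Ck_on k \<Omega> u \<Longrightarrow> continuous_on \<Omega> u"
  by (cases k) (auto intro!: continuous_at_imp_continuous_on differentiable_imp_continuous_within)

lemma Ck_on_lower: "Ck_on (Suc k) \<Omega> u \<Longrightarrow> Ck_on k \<Omega> u"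
proof (induction k arbitrary: u)
  case 0 then show ?case using Ck_on_continuous by (metis Ck_on.simps(1))
next
  case (Suc k) then show ?case by (simp del: Ck_on.simps(2) add: Ck_on.simps(2)[of _ \<Omega> u])
qed

lemma Ck_on_subset: "Ck_on k S u \<Longrightarrow> T \<subseteq> S \<Longrightarrow> Ck_on k T u"
  by (induction k arbitrary: u) (auto intro: continuous_on_subset)

lemma Ck_on_const: "Ck_on k UNIV (\<lambda>x. c)"
proof (induction k arbitrary: c)
  case (Suc k)
  have "partial_deriv i (\<lambda>x. c) = (\<lambda>x. 0)" for i :: 'a by (simp add: fun_eq_iff partial_deriv_const)
  then show ?case using Suc[of 0] by simp
qed simp

lemma Ck_on_nth: "Ck_on k UNIV (\<lambda>x. x $ j)"
proof (cases k)
  case 0 then show ?thesis by (auto intro!: continuous_intros)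
next
  case (Suc k)
  have "partial_deriv i (\<lambda>x. x $ j) = (\<lambda>x. if i = j then 1 else 0)" for i
    by (simp add: fun_eq_iff partial_deriv_nth)
  moreover have "(\<lambda>x. x $ j) differentiable (at x)" for x :: "real^'a"
    by (intro bounded_linear_imp_differentiable bounded_linear_vec_nth)
  ultimately show ?thesis using Suc by (simp add: Ck_on_const)
qed

lemma Ck_on_add: "Ck_on k UNIV u \<Longrightarrow> Ck_on k UNIV v \<Longrightarrow> Ck_on k UNIV (\<lambda>x. u x + v x)"
proof (induction k arbitrary: u v)
  case (Suc k)
  then have "partial_deriv i (\<lambda>x. u x + v x) = (\<lambda>x. partial_deriv i u x + partial_deriv i v x)" for i
    by (auto simp: fun_eq_iff partial_deriv_add)
  then show ?case using Suc by auto
qed (auto intro: continuous_intros)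

lemma Ck_on_mult: "Ck_on k UNIV u \<Longrightarrow> Ck_on k UNIV v \<Longrightarrow> Ck_on k UNIV (\<lambda>x. u x * v x)"
proof (induction k arbitrary: u v)
  case (Suc k)
  then have "partial_deriv i (\<lambda>x. u x * v x) = (\<lambda>x. u x * partial_deriv i v x + partial_deriv i u x * v x)" for i
    by (auto simp: fun_eq_iff partial_deriv_mult)
  moreover have "Ck_on k UNIV u" "Ck_on k UNIV v" using Suc.prems by (auto intro: Ck_on_lower)
  ultimately show ?case using Suc by (auto intro!: Ck_on_add)
qed (auto intro: continuous_intros)

section \<open>Smooth bump functions\<close>

text \<open>
With \<open>p = 1\<close> this is the classical smooth function that is flat at \<open>0\<close>. The polynomial factor makes
the family closed under differentiation, so smoothness follows by induction over the family.
\<close>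

definition flat :: "real poly \<Rightarrow> real \<Rightarrow> real" where
  "flat p t = (if 0 < t then poly p (1 / t) * exp (- (1 / t)) else 0)"

text \<open>
In the variable \<open>s = 1 / t\<close> the limit from the right is that of a polynomial times \<open>exp (- s)\<close> at
infinity.
\<close>

lemma flat_tendsto_0: "(flat p \<longlongrightarrow> 0) (at 0)"
proof (rule filterlim_split_at)
  have "((\<lambda>s. poly p s * exp (- s)) \<longlongrightarrow> 0) at_top"
  proof -
    have "((\<lambda>s. \<Sum>i\<le>degree p. coeff p i * (s ^ i / exp s)) \<longlongrightarrow> (\<Sum>i\<le>degree p. coeff p i * 0)) at_top"
      by (intro tendsto_intros tendsto_power_div_exp_0)
    then show ?thesis
      by (simp add: poly_altdef exp_minus divide_inverse sum_distrib_right mult.assoc)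
  qed
  from filterlim_compose[OF this filterlim_inverse_at_top_right]
  have "((\<lambda>t. poly p (1 / t) * exp (- (1 / t))) \<longlongrightarrow> 0) (at_right 0)"
    by (simp add: inverse_eq_divide)
  then show "(flat p \<longlongrightarrow> 0) (at_right 0)"
    by (rule Lim_transform_eventually)
       (auto simp: flat_def eventually_at_right_less intro: eventually_mono[OF eventually_at_right_less])
  show "(flat p \<longlongrightarrow> 0) (at_left 0)"
    by (rule Lim_transform_eventually[OF tendsto_const])
       (auto simp: flat_def eventually_at_filter)
qed

text \<open>
For \<open>t > 0\<close> the product and chain rules produce the new polynomial \<open>s\<^sup>2 (p(s) - p'(s))\<close> with
\<open>s = 1 / t\<close>. At \<open>0\<close> the difference quotient of \<open>flat p\<close> is itself in the family, with polynomial
\<open>s p(s)\<close>, and so it tends to \<open>0\<close>.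
\<close>

lemma flat_has_derivative:
  "(flat p has_real_derivative flat ([:0, 0, 1:] * (p - pderiv p)) t) (at t)"
proof -
  consider "0 < t" | "t < 0" | "t = 0" by linarith
  then show ?thesis
  proof cases
    case 1
    have "((\<lambda>t. poly p (1 / t) * exp (- (1 / t))) has_real_derivative
        flat ([:0, 0, 1:] * (p - pderiv p)) t) (at t)"
      using 1 by (auto intro!: derivative_eq_intros DERIV_chain'[OF _ poly_DERIV]
          simp: flat_def field_simps power2_eq_square)
    then show ?thesis
      by (rule has_field_derivative_transform_within_open[where S = "{0<..}"])
         (use 1 in \<open>auto simp: flat_def\<close>)
  next
    case 2
    have "((\<lambda>t. 0) has_real_derivative flat ([:0, 0, 1:] * (p - pderiv p)) t) (at t)"
      using 2 by (simp add: flat_def)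
    then show ?thesis
      by (rule has_field_derivative_transform_within_open[where S = "{..<0}"])
         (use 2 in \<open>auto simp: flat_def\<close>)
  next
    case 3
    have "(\<lambda>h. (flat p (0 + h) - flat p 0) / h) = flat ([:0, 1:] * p)"
      by (auto simp: flat_def)
    then show ?thesis
      using flat_tendsto_0[of "[:0, 1:] * p"] 3 by (simp add: DERIV_def flat_def)
  qed
qed

text \<open>
Each partial derivative is a function of the same form, with another polynomial, times a
coordinate. The induction is therefore over all polynomials at once.
\<close>

lemma Ck_on_flat_bump: "Ck_on k UNIV (\<lambda>x::real^'n::finite. flat p (c - x \<bullet> x))"
proof (induction k arbitrary: p)
  case 0
  have "continuous_on UNIV (flat p)"
    by (rule continuous_at_imp_continuous_on) (auto intro: DERIV_isCont flat_has_derivative)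
  moreover have "continuous_on UNIV (\<lambda>x::real^'n. c - x \<bullet> x)" by (intro continuous_intros)
  ultimately show ?case by (auto intro: continuous_on_compose2)
next
  case (Suc k)
  let ?q = "[:0, 0, 1:] * (p - pderiv p)"
  have D: "((\<lambda>x::real^'n. flat p (c - x \<bullet> x)) has_derivative
      (\<lambda>h. flat ?q (c - x \<bullet> x) * (- (2 * (x \<bullet> h))))) (at x)" for x
  proof -
    have "((\<lambda>x::real^'n. c - x \<bullet> x) has_derivative (\<lambda>h. - (2 * (x \<bullet> h)))) (at x)"
      by (auto intro!: derivative_eq_intros simp: inner_commute)
    from has_derivative_compose[OF this flat_has_derivative[THEN has_field_derivative_imp_has_derivative]]
    show ?thesis by simp
  qed
  have "partial_deriv i (\<lambda>x::real^'n. flat p (c - x \<bullet> x)) =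
      (\<lambda>x. flat ?q (c - x \<bullet> x) * ((- 2) * x $ i))" for i
    by (auto simp: fun_eq_iff partial_deriv_eq[OF D] inner_axis)
  moreover have "(\<lambda>x::real^'n. flat p (c - x \<bullet> x)) differentiable at x" for x
    using D by (auto simp: differentiable_def)
  ultimately show ?case
    using Suc[of ?q] by (simp only: Ck_on.simps) (intro conjI ballI allI Ck_on_mult Ck_on_const Ck_on_nth, simp_all)
qed

text \<open>
The bump \<open>flat 1 (\<epsilon>\<^sup>2 - x \<bullet> x)\<close>, divided by its integral. The integral is positive because the bump
is continuous, nonnegative and nonzero at the origin.
\<close>

lemma exists_mollifier:
  assumes "0 < \<epsilon>"
  obtains \<eta> :: "real ^ 'n::finite \<Rightarrow> real"
  where "\<And>k. Ck_on k UNIV \<eta>" "\<And>x. 0 \<le> \<eta> x" "\<And>x. \<epsilon> \<le> norm x \<Longrightarrow> \<eta> x = 0"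
    "(\<eta> has_integral 1) UNIV"
proof -
  let ?b = "\<lambda>x::real^'n. flat 1 (\<epsilon>\<^sup>2 - x \<bullet> x)"
  let ?Q = "cbox (- (\<chi> i. \<epsilon>)) (\<chi> i. \<epsilon>) :: (real^'n) set"
  have Ck: "Ck_on k UNIV ?b" for k by (rule Ck_on_flat_bump)
  have zero: "?b x = 0" if "\<epsilon> \<le> norm x" for x
    using power_mono[OF that, of 2] assms by (simp add: flat_def power2_norm_eq_inner)
  have nonneg: "0 \<le> ?b x" for x by (simp add: flat_def)
  have cont: "continuous_on A ?b" for A
    using Ck_on_continuous[OF Ck] continuous_on_subset by blast
  obtain I where I: "(?b has_integral I) ?Q"
    using integrable_continuous[OF cont] unfolding integrable_on_def by blast
  have outside: "?b x = 0" if "x \<notin> ?Q" for x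
  proof (rule zero, rule ccontr)
    assume "\<not> \<epsilon> \<le> norm x"
    then have "\<bar>x $ i\<bar> \<le> \<epsilon>" for i using component_le_norm_cart[of x i] by linarith
    then have "x \<in> ?Q" by (simp add: mem_box_cart abs_le_iff minus_le_iff)
    then show False using that by simp
  qed
  have U: "(?b has_integral I) UNIV"
    by (rule has_integral_on_superset[OF I]) (use outside in auto)
  have "I \<noteq> 0"
  proof
    assume "I = 0"
    have "?b 0 = 0"
    proof (rule has_integral_0_cbox_imp_0[OF cont])
      show "(?b has_integral 0) ?Q" using I \<open>I = 0\<close> by simp
      show "box (- (\<chi> i. \<epsilon>)) (\<chi> i. \<epsilon>) \<noteq> ({} :: (real^'n) set)"
        using assms by (auto simp: interval_ne_empty_cart)
    qed (use assms nonneg in \<open>auto simp: mem_box_cart\<close>)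
    then show False using assms by (simp add: flat_def)
  qed
  moreover have "I \<ge> 0" using has_integral_nonneg[OF U] nonneg by auto
  ultimately have "I > 0" by simp
  show ?thesis
  proof (rule that[of "\<lambda>x. inverse I * ?b x"])
    show "Ck_on k UNIV (\<lambda>x. inverse I * ?b x)" for k by (intro Ck_on_mult Ck_on_const Ck)
    show "((\<lambda>x. inverse I * ?b x) has_integral 1) UNIV"
      using has_integral_mult_right[OF U, of "inverse I"] \<open>I > 0\<close> by simp
  qed (use \<open>I > 0\<close> nonneg zero in auto)
qed

section \<open>Approximation by convolution with mollifiers\<close>

definition convolution :: "(real ^ 'n::finite \<Rightarrow> real) \<Rightarrow> (real ^ 'n \<Rightarrow> real) \<Rightarrow> real ^ 'n \<Rightarrow> real" where
  "convolution v w x = integral UNIV (\<lambda>y. v y * w (x - y))"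

lemma convolution_eq_integral_cbox:
  assumes "\<And>y. y \<notin> cbox a b \<Longrightarrow> v y = 0"
  shows "convolution v w x = integral (cbox a b) (\<lambda>y. v y * w (x - y))"
proof -
  have "convolution v w x = integral UNIV (\<lambda>y. if y \<in> cbox a b then v y * w (x - y) else 0)"
    unfolding convolution_def using assms by (intro arg_cong[where f = "integral UNIV"]) auto
  also have "\<dots> = integral (cbox a b) (\<lambda>y. v y * w (x - y))"
    using integral_restrict_UNIV[of "cbox a b" "\<lambda>y. v y * w (x - y)"] .
  finally show ?thesis .
qed

lemma bounded_support_cbox:
  fixes v :: "'a::euclidean_space \<Rightarrow> 'b::zero"
  assumes "bounded {y. v y \<noteq> 0}"
  obtains a b where "\<And>y. y \<notin> cbox a b \<Longrightarrow> v y = 0"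
proof -
  obtain a where "{y. v y \<noteq> 0} \<subseteq> cbox (- a) a"
    using bounded_subset_cbox_symmetric[OF assms] .
  then show ?thesis by (intro that[of "- a" a]) auto
qed

text \<open>
All derivatives are put on the second factor, where the variable \<open>x\<close> sits. The first factor only
has to be continuous with bounded support: this reduces the integral to a box, on which the
derivative may be taken under the integral sign.
\<close>

lemma convolution_derivative:
  fixes v w :: "real ^ 'n::finite \<Rightarrow> real"
  assumes v: "continuous_on UNIV v" "bounded {y. v y \<noteq> 0}" and w: "Ck_on 1 UNIV w"
  shows "convolution v w differentiable (at x)"
    and "partial_deriv i (convolution v w) x = convolution v (partial_deriv i w) x"
proof -
  obtain a b where off: "\<And>y. y \<notin> cbox a b \<Longrightarrow> v y = 0"
    using bounded_support_cbox[OF v(2)] by blast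
  have eq: "convolution v w x = integral (cbox a b) (\<lambda>y. v y * w (x - y))" for w x
    by (rule convolution_eq_integral_cbox) (rule off)
  have w': "continuous_on A w" "continuous_on A (partial_deriv i w)" "w differentiable (at x)" for A i x
    using w Ck_on_continuous[OF w] by (auto intro: continuous_on_subset)
  have v': "continuous_on A v" for A using v(1) continuous_on_subset by blast
  define D :: "real^'n \<Rightarrow> real^'n \<Rightarrow> (real^'n) \<Rightarrow>\<^sub>L real" where
    "D x t = v t *\<^sub>R (\<Sum>i\<in>UNIV. partial_deriv i w (x - t) *\<^sub>R blinfun_inner_left (axis i 1))" for x t
  have D_apply: "D x t h = v t * (\<Sum>i\<in>UNIV. partial_deriv i w (x - t) * h $ i)" for x t h
    by (simp add: D_def blinfun.scaleR_left blinfun.sum_left inner_axis)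
  have cont_D: "continuous_on (UNIV \<times> cbox a b) (\<lambda>(x, t). D x t)"
    unfolding D_def split_beta
    by (intro continuous_intros continuous_on_compose2[OF v'[of UNIV]] continuous_on_compose2[OF w'(2)[of UNIV]]) auto
  have cont_Dx: "continuous_on (cbox a b) (D x)" for x
    using continuous_on_compose2[OF cont_D, of "cbox a b" "\<lambda>t. (x, t)"]
    by (auto intro!: continuous_intros simp: continuous_on_Pair)
  have der: "(convolution v w has_derivative integral (cbox a b) (D x)) (at x)"
  proof -
    have "((\<lambda>x. integral (cbox a b) (\<lambda>y. v y * w (x - y))) has_derivative integral (cbox a b) (D x))
        (at x within UNIV)"
    proof (rule leibniz_rule[where fx = D, OF _ _ cont_D])
      fix x t
      have "((\<lambda>x. w (x - t)) has_derivative (\<lambda>h. \<Sum>i\<in>UNIV. partial_deriv i w (x - t) * h $ i)) (at x)"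
        by (rule has_derivative_compose[OF _ has_derivative_partial_deriv[OF w'(3)], where f = "\<lambda>x. x - t" and f' = "\<lambda>h. h"])
           (auto intro!: derivative_eq_intros)
      then show "((\<lambda>x. v t * w (x - t)) has_derivative D x t) (at x within UNIV)"
        by (auto simp: D_apply intro!: derivative_eq_intros)
    qed (auto intro!: integrable_continuous continuous_intros v' continuous_on_compose2[OF w'(1)[of UNIV]])
    then show ?thesis by (simp add: eq[abs_def])
  qed
  then show "convolution v w differentiable (at x)" by (auto simp: differentiable_def)
  have "partial_deriv i (convolution v w) x = integral (cbox a b) (D x) (axis i 1)"
    by (rule partial_deriv_eq[OF der])
  also have "\<dots> = integral (cbox a b) (\<lambda>t. D x t (axis i 1))"
    by (rule blinfun_apply_integral) (rule integrable_continuous[OF cont_Dx])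
  also have "\<dots> = integral (cbox a b) (\<lambda>t. v t * partial_deriv i w (x - t))"
    by (simp add: D_apply axis_def if_distrib cong: if_cong)
  finally show "partial_deriv i (convolution v w) x = convolution v (partial_deriv i w) x"
    by (simp add: eq)
qed

lemma Ck_on_convolution:
  fixes v w :: "real ^ 'n::finite \<Rightarrow> real"
  assumes v: "continuous_on UNIV v" "bounded {y. v y \<noteq> 0}" and w: "\<And>k. Ck_on k UNIV w"
  shows "Ck_on k UNIV (convolution v w)"
  using w
proof (induction k arbitrary: w)
  case 0
  have "isCont (convolution v w) x" for x
    using convolution_derivative(1)[OF v 0] by (rule differentiable_imp_continuous_within)
  then show ?case by (simp add: continuous_at_imp_continuous_on)
next
  case (Suc k)
  have "Ck_on k UNIV (partial_deriv i w)" for k i using Suc.prems[of "Suc k"] by simp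
  moreover have "partial_deriv i (convolution v w) = convolution v (partial_deriv i w)" for i
    using convolution_derivative(2)[OF v Suc.prems] by auto
  ultimately show ?case using convolution_derivative(1)[OF v Suc.prems] Suc.IH by simp
qed

lemma convolution_integrable:
  fixes v w :: "real ^ 'n::finite \<Rightarrow> real"
  assumes v: "continuous_on UNIV v" "bounded {y. v y \<noteq> 0}" and w: "continuous_on UNIV w"
  shows "(\<lambda>y. v y * w (x - y)) integrable_on UNIV"
proof -
  obtain a b where off: "\<And>y. y \<notin> cbox a b \<Longrightarrow> v y = 0"
    using bounded_support_cbox[OF v(2)] by blast
  have "(\<lambda>y. v y * w (x - y)) integrable_on cbox a b"
    by (intro integrable_continuous continuous_intros continuous_on_subset[OF v(1)]
        continuous_on_compose2[OF w]) auto
  then show ?thesis by (rule integrable_on_superset) (use off in auto)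
qed

text \<open>
This is the substitution \<open>y \<mapsto> x - y\<close>. It lets derivatives fall on either factor: on the mollifier
to see that the convolution is smooth, on the approximated function to see that the derivatives
converge too.
\<close>

lemma convolution_commute:
  fixes v w :: "real ^ 'n::finite \<Rightarrow> real"
  assumes v: "continuous_on UNIV v" "bounded {y. v y \<noteq> 0}" and w: "continuous_on UNIV w"
  shows "convolution w v = convolution v w"
proof
  fix x
  obtain a b where off: "\<And>y. y \<notin> cbox a b \<Longrightarrow> v y = 0"
    using bounded_support_cbox[OF v(2)] by blast
  have "(\<lambda>y. v y * w (x - y)) integrable_on cbox a b"
    by (intro integrable_continuous continuous_intros continuous_on_subset[OF v(1)]
        continuous_on_compose2[OF w]) auto
  then have "((\<lambda>y. v y * w (x - y)) has_integral convolution v w x) (cbox a b)"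
    by (subst convolution_eq_integral_cbox[of a b]) (auto simp: off integrable_integral)
  from has_integral_affinity[OF this, of "-1" x]
  have I: "((\<lambda>y. w y * v (x - y)) has_integral convolution v w x) ((\<lambda>y. x - y) ` cbox a b)"
    by (simp add: mult.commute[of "w _"])
  have "((\<lambda>y. w y * v (x - y)) has_integral convolution v w x) UNIV"
  proof (rule has_integral_on_superset[OF I])
    fix y assume "y \<notin> (\<lambda>y. x - y) ` cbox a b"
    then have "x - y \<notin> cbox a b" using image_eqI[of y "\<lambda>y. x - y" "x - y" "cbox a b"] by auto
    then show "w y * v (x - y) = 0" using off by simp
  qed auto
  then show "convolution w v x = convolution v w x" by (simp add: convolution_def integral_unique)
qed

definition mollifier :: "real \<Rightarrow> (real ^ 'n::finite \<Rightarrow> real) \<Rightarrow> bool" where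
  "mollifier \<epsilon> \<eta> \<longleftrightarrow> (\<forall>k. Ck_on k UNIV \<eta>) \<and> (\<forall>x. 0 \<le> \<eta> x) \<and> (\<forall>x. \<epsilon> \<le> norm x \<longrightarrow> \<eta> x = 0)
     \<and> (\<eta> has_integral 1) UNIV"

lemma mollifier_bounded_support: "mollifier \<epsilon> \<eta> \<Longrightarrow> bounded {y. \<eta> y \<noteq> 0}"
  unfolding mollifier_def bounded_iff by (intro exI[of _ \<epsilon>]) force

lemma mollifier_continuous: "mollifier \<epsilon> \<eta> \<Longrightarrow> continuous_on UNIV \<eta>"
  unfolding mollifier_def using Ck_on_continuous[of 0 UNIV \<eta>] by auto

text \<open>
On a ball slightly larger than the support this is Heine's theorem. Two points at distance less
than \<open>1\<close> that are not both in that ball both lie outside the support.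
\<close>

lemma compact_support_uniformly_continuous:
  fixes v :: "'a::euclidean_space \<Rightarrow> 'b::real_normed_vector"
  assumes "continuous_on UNIV v" "bounded {y. v y \<noteq> 0}"
  shows "uniformly_continuous_on UNIV v"
proof -
  obtain B where B: "\<And>y. v y \<noteq> 0 \<Longrightarrow> norm y \<le> B" using assms(2) by (auto simp: bounded_iff)
  have uc: "uniformly_continuous_on (cball 0 (B + 1)) v"
    by (intro compact_uniformly_continuous continuous_on_subset[OF assms(1)]) auto
  show ?thesis
    unfolding uniformly_continuous_on_def
  proof (intro allI impI)
    fix e :: real assume "0 < e"
    with uc obtain d where d: "0 < d"
      "\<And>x y. norm x \<le> B + 1 \<Longrightarrow> norm y \<le> B + 1 \<Longrightarrow> dist y x < d \<Longrightarrow> dist (v y) (v x) < e"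
      unfolding uniformly_continuous_on_def by (metis mem_cball_0)
    have "dist (v y) (v x) < e" if "dist y x < min d 1" for x y
    proof (cases "norm x \<le> B + 1 \<and> norm y \<le> B + 1")
      case True then show ?thesis using d that by auto
    next
      case False
      have "\<bar>norm y - norm x\<bar> \<le> dist y x" by (simp add: dist_norm norm_triangle_ineq3)
      then have "norm x > B" "norm y > B" using False that by linarith+
      then have "v x = 0" "v y = 0" using B by force+
      then show ?thesis using \<open>0 < e\<close> by simp
    qed
    then show "\<exists>d>0. \<forall>x\<in>UNIV. \<forall>x'\<in>UNIV. dist x' x < d \<longrightarrow> dist (v x') (v x) < e"
      using d(1) by (intro exI[of _ "min d 1"]) auto
  qed
qed

text \<open>
The convolution is a weighted average of the values of \<open>v\<close> at distance less than \<open>\<epsilon>\<close>, so its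
distance to \<open>v\<close> is at most the oscillation of \<open>v\<close> at that scale.
\<close>

lemma convolution_mollifier_tendsto:
  fixes v :: "real ^ 'n::finite \<Rightarrow> real"
  assumes v: "continuous_on UNIV v" "bounded {y. v y \<noteq> 0}" and "0 < \<delta>"
  shows "\<forall>\<^sub>F \<epsilon> in at_right 0. \<forall>\<eta>. mollifier \<epsilon> \<eta> \<longrightarrow> (\<forall>x. \<bar>convolution \<eta> v x - v x\<bar> \<le> \<delta>)"
proof -
  obtain d where "0 < d" and d: "\<And>x y. dist y x < d \<Longrightarrow> dist (v y) (v x) < \<delta>"
    using uniformly_continuous_onE[OF compact_support_uniformly_continuous[OF v] \<open>0 < \<delta>\<close>]
    by (metis UNIV_I)
  have "\<bar>convolution \<eta> v x - v x\<bar> \<le> \<delta>" if "\<epsilon> < d" and \<eta>: "mollifier \<epsilon> \<eta>" for \<epsilon> \<eta> x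
  proof -
    have int: "(\<eta> has_integral 1) UNIV" using \<eta> by (simp add: mollifier_def)
    have "((\<lambda>y. \<eta> y * v (x - y)) has_integral convolution \<eta> v x) UNIV"
      unfolding convolution_def
      by (intro integrable_integral convolution_integrable v mollifier_continuous[OF \<eta>]
          mollifier_bounded_support[OF \<eta>])
    then have I: "((\<lambda>y. \<eta> y * v (x - y) - \<eta> y * v x) has_integral (convolution \<eta> v x - v x)) UNIV"
      using has_integral_mult_left[OF int, of "v x"] by (auto intro: has_integral_diff)
    have J: "((\<lambda>y. \<eta> y * \<delta>) has_integral \<delta>) UNIV"
      using has_integral_mult_left[OF int, of \<delta>] by simp
    have "norm (\<eta> y * v (x - y) - \<eta> y * v x) \<le> \<eta> y * \<delta>" for y
    proof (cases "\<epsilon> \<le> norm y")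
      case True then show ?thesis using \<eta> by (simp add: mollifier_def)
    next
      case False
      then have "\<bar>v (x - y) - v x\<bar> \<le> \<delta>" using d[of "x - y" x] that(1) by (simp add: dist_norm)
      then have "\<eta> y * \<bar>v (x - y) - v x\<bar> \<le> \<eta> y * \<delta>"
        using \<eta> by (intro mult_left_mono) (auto simp: mollifier_def)
      moreover have "0 \<le> \<eta> y" using \<eta> by (simp add: mollifier_def)
      ultimately show ?thesis by (simp add: abs_mult flip: right_diff_distrib)
    qed
    with integral_norm_bound_integral[of _ UNIV, OF has_integral_integrable[OF I] has_integral_integrable[OF J]]
    show ?thesis by (simp add: integral_unique[OF I] integral_unique[OF int])
  qed
  then show ?thesis
    unfolding eventually_at_right_field using \<open>0 < d\<close> by blast
qed

text \<open>
One and the same mollification is close to \<open>v\<close>, and to \<open>v\<close> in \<open>C\<^sup>1\<close> if \<open>v\<close> is \<open>C\<^sup>1\<close>, because mollifying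
commutes with partial derivatives. The support grows by at most \<open>\<epsilon>\<close>, which is taken so small
that this neighbourhood of \<open>K\<close> stays inside \<open>\<Omega>\<close>.
\<close>

theorem test_functions_dense_C1:
  fixes v :: "real ^ 'n::finite \<Rightarrow> real"
  assumes "open \<Omega>" "compact K" "K \<subseteq> \<Omega>" and v: "continuous_on UNIV v" "\<And>x. x \<notin> K \<Longrightarrow> v x = 0"
    and "0 < \<delta>"
  obtains u where "u \<in> test_functions \<Omega>" "\<And>x. \<bar>u x - v x\<bar> \<le> \<delta>"
    "\<And>i x. Ck_on 1 UNIV v \<Longrightarrow> \<bar>partial_deriv i u x - partial_deriv i v x\<bar> \<le> \<delta>"
proof -
  have supp: "bounded {y. w y \<noteq> 0}" if "\<And>x. x \<notin> K \<Longrightarrow> w x = 0" for w :: "real^'n \<Rightarrow> real"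
    by (rule bounded_subset[OF compact_imp_bounded[OF \<open>compact K\<close>]]) (use that in auto)
  obtain r where "0 < r" and r: "(\<Union>x\<in>K. cball x r) \<subseteq> \<Omega>"
    using compact_subset_open_imp_cball_epsilon_subset[OF assms(2,1,3)] by blast
  define close where "close \<epsilon> w \<longleftrightarrow>
      (\<forall>\<eta>. mollifier \<epsilon> \<eta> \<longrightarrow> (\<forall>x. \<bar>convolution \<eta> w x - w x\<bar> \<le> \<delta>))" for \<epsilon> and w :: "real^'n \<Rightarrow> real"
  have "\<forall>\<^sub>F \<epsilon> in at_right 0. close \<epsilon> v"
    unfolding close_def by (intro convolution_mollifier_tendsto v supp assms)
  moreover have "\<forall>\<^sub>F \<epsilon> in at_right 0. \<forall>i. Ck_on 1 UNIV v \<longrightarrow> close \<epsilon> (partial_deriv i v)"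
  proof (rule eventually_all_finite)
    fix i
    have "open (- K)" using \<open>compact K\<close> by (simp add: compact_imp_closed open_Compl)
    then have "partial_deriv i v x = 0" if "x \<notin> K" for x
      by (rule partial_deriv_eq_0) (use that v(2) in auto)
    then show "\<forall>\<^sub>F \<epsilon> in at_right 0. Ck_on 1 UNIV v \<longrightarrow> close \<epsilon> (partial_deriv i v)"
      using convolution_mollifier_tendsto[OF _ supp \<open>0 < \<delta>\<close>, of "partial_deriv i v"]
      by (cases "Ck_on 1 UNIV v") (auto simp: close_def)
  qed
  moreover have "\<forall>\<^sub>F \<epsilon> in at_right 0. 0 < \<epsilon> \<and> \<epsilon> < r"
    using \<open>0 < r\<close> by (auto simp: eventually_at_right_field)
  ultimately have "\<forall>\<^sub>F \<epsilon> in at_right 0. (0 < \<epsilon> \<and> \<epsilon> < r) \<and> close \<epsilon> v \<and>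
      (\<forall>i. Ck_on 1 UNIV v \<longrightarrow> close \<epsilon> (partial_deriv i v))"
    by eventually_elim auto
  from eventually_happens'[OF trivial_limit_at_right_real this]
  obtain \<epsilon> where \<epsilon>: "0 < \<epsilon>" "\<epsilon> < r" "close \<epsilon> v"
      "\<And>i. Ck_on 1 UNIV v \<Longrightarrow> close \<epsilon> (partial_deriv i v)"
    by blast
  obtain \<eta> :: "real^'n \<Rightarrow> real" where \<eta>: "mollifier \<epsilon> \<eta>"
    unfolding mollifier_def by (rule exists_mollifier[OF \<epsilon>(1)]) blast
  let ?u = "convolution \<eta> v"
  have u_eq: "?u = convolution v \<eta>"
    by (intro convolution_commute v supp mollifier_continuous[OF \<eta>])
  have "compact (\<Union>x\<in>K. cball x r)" by (rule compact_minkowski_sum_cball[OF \<open>compact K\<close>])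
  moreover have "{x \<in> \<Omega>. ?u x \<noteq> 0} \<subseteq> (\<Union>x\<in>K. cball x r)"
  proof clarify
    fix x assume "?u x \<noteq> 0"
    then obtain y where "\<eta> y * v (x - y) \<noteq> 0"
      unfolding convolution_def by (cases "\<forall>y. \<eta> y * v (x - y) = 0") auto
    then have "norm y < \<epsilon>" "x - y \<in> K"
      using \<eta> v(2)[of "x - y"] unfolding mollifier_def by (auto simp flip: not_le)
    then show "x \<in> (\<Union>x\<in>K. cball x r)" using \<open>\<epsilon> < r\<close>
      by (intro UN_I[of "x - y"]) (auto simp: dist_norm)
  qed
  ultimately have "closure {x \<in> \<Omega>. ?u x \<noteq> 0} \<subseteq> (\<Union>x\<in>K. cball x r)"
    by (meson closure_minimal compact_imp_closed)
  then have "compactly_supported_in \<Omega> ?u"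
    unfolding compactly_supported_in_def
    using r bounded_subset[OF compact_imp_bounded[OF \<open>compact (\<Union>x\<in>K. cball x r)\<close>]]
    by (auto simp: compact_eq_bounded_closed)
  moreover have "Ck_on k \<Omega> ?u" for k
    unfolding u_eq using \<eta>
    by (intro Ck_on_subset[OF Ck_on_convolution[OF v(1) supp[OF v(2)]]]) (auto simp: mollifier_def)
  ultimately have "?u \<in> test_functions \<Omega>" by (simp add: test_functions_def)
  moreover have "\<bar>partial_deriv i ?u x - partial_deriv i v x\<bar> \<le> \<delta>" if "Ck_on 1 UNIV v" for i x
    using \<epsilon>(4)[OF that] \<eta>
      convolution_derivative(2)[OF mollifier_continuous[OF \<eta>] mollifier_bounded_support[OF \<eta>] that]
    by (simp add: close_def)
  moreover have "\<bar>?u x - v x\<bar> \<le> \<delta>" for x using \<epsilon>(3) \<eta> by (simp add: close_def)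
  ultimately show ?thesis using that by blast
qed

section \<open>Weak derivatives tested against \<open>C\<^sup>1\<close> functions\<close>

lemma set_integral_finite_sum:
  fixes f :: "'i \<Rightarrow> 'a \<Rightarrow> 'b::{banach, second_countable_topology}"
  assumes "\<And>i. i \<in> I \<Longrightarrow> set_integrable M A (f i)"
  shows "set_integrable M A (\<lambda>x. \<Sum>i\<in>I. f i x)"
    and "(LINT x:A|M. (\<Sum>i\<in>I. f i x)) = (\<Sum>i\<in>I. LINT x:A|M. f i x)"
  using assms by (auto simp: set_integrable_def set_lebesgue_integral_def scaleR_sum_right)

lemma set_integrable_bounded_product:
  fixes w :: "real ^ 'n::finite \<Rightarrow> 'a::euclidean_space" and G :: "real ^ 'n \<Rightarrow> 'b::euclidean_space"
    and h :: "'a \<Rightarrow> 'b \<Rightarrow> 'c::euclidean_space"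
  assumes "open \<Omega>" "continuous_on \<Omega> w" "bounded (w ` \<Omega>)" "set_integrable lebesgue \<Omega> G" "bilinear h"
  shows "set_integrable lebesgue \<Omega> (\<lambda>x. h (w x) (G x))"
proof -
  have \<Omega>: "\<Omega> \<in> sets lebesgue" using \<open>open \<Omega>\<close> by simp
  show ?thesis
    by (rule absolutely_integrable_bounded_measurable_product[OF assms(5) _ \<Omega> assms(3,4)])
       (rule continuous_imp_measurable_on_sets_lebesgue[OF assms(2) \<Omega>])
qed

lemma set_integrable_mult_bounded:
  fixes w f :: "real ^ 'n::finite \<Rightarrow> real"
  assumes "open \<Omega>" "continuous_on \<Omega> w" "bounded (w ` \<Omega>)" "set_integrable lebesgue \<Omega> f"
  shows "set_integrable lebesgue \<Omega> (\<lambda>x. f x * w x)"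
  using set_integrable_bounded_product[OF assms bilinear_times] by (simp add: mult.commute)

lemma bounded_image_compact_support:
  fixes w :: "'a::topological_space \<Rightarrow> 'b::real_normed_vector"
  assumes "continuous_on \<Omega> w" "compact K" "K \<subseteq> \<Omega>" "\<And>x. x \<in> \<Omega> - K \<Longrightarrow> w x = 0"
  shows "bounded (w ` \<Omega>)"
proof -
  have "bounded (insert 0 (w ` K))"
    using compact_continuous_image[OF continuous_on_subset[OF assms(1,3)] assms(2)]
    by (simp add: compact_imp_bounded)
  then show ?thesis by (rule bounded_subset) (use assms(4) in auto)
qed

lemma compactly_supported_inE:
  assumes "compactly_supported_in \<Omega> u"
  obtains K where "compact K" "K \<subseteq> \<Omega>" "\<And>x. x \<in> \<Omega> - K \<Longrightarrow> u x = 0"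
proof (rule that[of "closure {x \<in> \<Omega>. u x \<noteq> 0}"])
  show "u x = 0" if "x \<in> \<Omega> - closure {x \<in> \<Omega>. u x \<noteq> 0}" for x
    using that closure_subset[of "{x \<in> \<Omega>. u x \<noteq> 0}"] by auto
qed (use assms in \<open>auto simp: compactly_supported_in_def\<close>)

lemma compactly_supported_inI:
  fixes u :: "'a::t2_space \<Rightarrow> 'b::zero"
  assumes "compact K" "K \<subseteq> \<Omega>" "\<And>x. x \<in> \<Omega> - K \<Longrightarrow> u x = 0"
  shows "compactly_supported_in \<Omega> u"
proof -
  have "closure {x \<in> \<Omega>. u x \<noteq> 0} \<subseteq> K"
    by (rule closure_minimal) (use assms in \<open>auto intro: compact_imp_closed\<close>)
  then show ?thesis
    using compact_Int_closed[OF assms(1) closed_closure[of "{x \<in> \<Omega>. u x \<noteq> 0}"]] assms(2)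
    by (auto simp: compactly_supported_in_def Int_absorb1)
qed

text \<open>
A field on \<open>\<Omega>\<close> has arbitrary values outside \<open>\<Omega>\<close>, while mollification averages over the whole space.
Its values outside must therefore first be replaced by \<open>0\<close>; this does not break differentiability
because the support is compact in \<open>\<Omega>\<close>.
\<close>

lemma C1_zero_extension:
  fixes u :: "real ^ 'n::finite \<Rightarrow> real"
  assumes "open \<Omega>" "compact K" "K \<subseteq> \<Omega>" "Ck_on 1 \<Omega> u" "\<And>x. x \<in> \<Omega> - K \<Longrightarrow> u x = 0"
  defines "v \<equiv> \<lambda>x. if x \<in> \<Omega> then u x else 0"
  shows "Ck_on 1 UNIV v" and "\<And>i x. x \<in> \<Omega> \<Longrightarrow> partial_deriv i v x = partial_deriv i u x"
proof -
  have opn: "open (- K)" using \<open>compact K\<close> by (simp add: compact_imp_closed open_Compl)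
  have in_\<Omega>: "v differentiable (at x)" "partial_deriv i v x = partial_deriv i u x" if "x \<in> \<Omega>" for i x
    using partial_deriv_transform[OF \<open>open \<Omega>\<close> that, of u v] assms(4) that by (auto simp: v_def)
  have off: "v y = 0" if "y \<in> - K" for y using that assms(5) by (auto simp: v_def)
  have "v differentiable (at x)" for x
  proof (cases "x \<in> \<Omega>")
    case False
    then have "x \<in> - K" using assms(3) by auto
    from partial_deriv_transform(1)[OF opn this, of "\<lambda>x. 0" v] off show ?thesis by simp
  qed (rule in_\<Omega>)
  moreover have "continuous_on UNIV (partial_deriv i v)" for i
  proof -
    have "continuous_on \<Omega> (partial_deriv i v)"
      using assms(4) in_\<Omega>(2) by (auto cong: continuous_on_cong)
    moreover have "continuous_on (- K) (partial_deriv i v)"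
    proof -
      have "partial_deriv i v x = 0" if "x \<in> - K" for x
        by (rule partial_deriv_eq_0[OF opn that]) (rule off)
      then show ?thesis
        using continuous_on_cong[of "- K" "- K" "partial_deriv i v" "\<lambda>x. 0"] by simp
    qed
    ultimately have "continuous_on (\<Omega> \<union> - K) (partial_deriv i v)"
      using \<open>open \<Omega>\<close> opn by (intro continuous_on_open_Un) auto
    moreover have "\<Omega> \<union> - K = UNIV" using assms(3) by auto
    ultimately show ?thesis by simp
  qed
  ultimately show "Ck_on 1 UNIV v" by simp
  show "\<And>i x. x \<in> \<Omega> \<Longrightarrow> partial_deriv i v x = partial_deriv i u x" by (rule in_\<Omega>)
qed

lemma C1c_integrable:
  fixes u f :: "real ^ 'n::finite \<Rightarrow> real"
  assumes "open \<Omega>" "Ck_on 1 \<Omega> u" "compactly_supported_in \<Omega> u" "set_integrable lebesgue \<Omega> f"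
  shows "set_integrable lebesgue \<Omega> (\<lambda>x. f x * u x)"
    and "set_integrable lebesgue \<Omega> (\<lambda>x. f x * partial_deriv i u x)"
proof -
  obtain K where K: "compact K" "K \<subseteq> \<Omega>" "\<And>x. x \<in> \<Omega> - K \<Longrightarrow> u x = 0"
    using assms(3) by (rule compactly_supported_inE) blast
  have opn: "open (\<Omega> - K)" using assms(1) K(1) by (simp add: compact_imp_closed open_Diff)
  show "set_integrable lebesgue \<Omega> (\<lambda>x. f x * u x)"
    by (intro set_integrable_mult_bounded assms bounded_image_compact_support[OF _ K]
        Ck_on_continuous[OF assms(2)])
  show "set_integrable lebesgue \<Omega> (\<lambda>x. f x * partial_deriv i u x)"
    using assms(2) partial_deriv_eq_0[OF opn _ K(3)]
    by (intro set_integrable_mult_bounded assms bounded_image_compact_support[OF _ K(1,2)]) auto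
qed

text \<open>
Weak derivatives are defined by smooth test functions, but the variation is defined by \<open>C\<^sup>1\<close> fields.
The two sides of the formula are continuous for uniform convergence of \<open>u\<close> and its derivatives, since
\<open>f\<close> and \<open>g\<close> are integrable, so density of the test functions carries the formula over.
\<close>

lemma weak_partial_C1:
  fixes u f g :: "real ^ 'n::finite \<Rightarrow> real"
  assumes \<Omega>: "open \<Omega>" and fg: "set_integrable lebesgue \<Omega> f" "set_integrable lebesgue \<Omega> g"
    and weak: "is_weak_partial \<Omega> i f g" and u: "Ck_on 1 \<Omega> u" "compactly_supported_in \<Omega> u"
  shows "(LINT x:\<Omega>|lebesgue. f x * partial_deriv i u x) = - (LINT x:\<Omega>|lebesgue. g x * u x)"
proof -
  obtain K where K: "compact K" "K \<subseteq> \<Omega>" "\<And>x. x \<in> \<Omega> - K \<Longrightarrow> u x = 0"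
    using u(2) by (rule compactly_supported_inE) blast
  define v where "v x = (if x \<in> \<Omega> then u x else 0)" for x
  have v: "Ck_on 1 UNIV v" "\<And>x. x \<in> \<Omega> \<Longrightarrow> partial_deriv i v x = partial_deriv i u x"
    using C1_zero_extension[OF \<Omega> K(1,2) u(1) K(3)] by (auto simp: v_def[abs_def])
  have v_off: "v x = 0" if "x \<notin> K" for x using that K(3) by (auto simp: v_def)
  define E where "E = (LINT x:\<Omega>|lebesgue. f x * partial_deriv i u x) + (LINT x:\<Omega>|lebesgue. g x * u x)"
  define C where "C = (LINT x:\<Omega>|lebesgue. \<bar>f x\<bar> + \<bar>g x\<bar>)"
  have absfg: "set_integrable lebesgue \<Omega> (\<lambda>x. \<bar>f x\<bar> + \<bar>g x\<bar>)"
    using fg by (intro set_integral_add set_integrable_abs)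
  have "C \<ge> 0" unfolding C_def by (simp add: set_lebesgue_integral_def)
  have E_bound: "\<bar>E\<bar> \<le> \<delta> * C" if \<delta>: "0 < \<delta>" for \<delta>
  proof -
    obtain t where t: "t \<in> test_functions \<Omega>" "\<And>x. \<bar>t x - v x\<bar> \<le> \<delta>"
        "\<And>x. \<bar>partial_deriv i t x - partial_deriv i v x\<bar> \<le> \<delta>"
      using test_functions_dense_C1[OF \<Omega> K(1,2) Ck_on_continuous[OF v(1)] v_off \<delta>] v(1) by metis
    have t': "Ck_on 1 \<Omega> t" "compactly_supported_in \<Omega> t" using t(1) by (auto simp: test_functions_def)
    note int = C1c_integrable[OF \<Omega> u] C1c_integrable[OF \<Omega> t']
    let ?d = "\<lambda>x. f x * (partial_deriv i u x - partial_deriv i t x) + g x * (u x - t x)"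
    have d_int: "set_integrable lebesgue \<Omega> ?d"
      unfolding right_diff_distrib by (intro set_integral_add set_integral_diff int fg)
    have "(LINT x:\<Omega>|lebesgue. f x * partial_deriv i t x) = - (LINT x:\<Omega>|lebesgue. g x * t x)"
      using weak t(1) by (simp add: is_weak_partial_def)
    then have "E = (LINT x:\<Omega>|lebesgue. ?d x)"
      unfolding right_diff_distrib E_def by (simp add: set_integral_add set_integral_diff int fg)
    then have "\<bar>E\<bar> \<le> (LINT x:\<Omega>|lebesgue. \<bar>?d x\<bar>)"
      using set_integral_norm_bound[OF d_int] by simp
    also have "\<dots> \<le> (LINT x:\<Omega>|lebesgue. \<delta> * (\<bar>f x\<bar> + \<bar>g x\<bar>))"
    proof (rule set_integral_mono)
      fix x assume "x \<in> \<Omega>"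
      then have "\<bar>partial_deriv i u x - partial_deriv i t x\<bar> \<le> \<delta>" "\<bar>u x - t x\<bar> \<le> \<delta>"
        using t(2,3)[of x] v(2)[of x] by (auto simp: v_def abs_minus_commute)
      then have "\<bar>f x\<bar> * \<bar>partial_deriv i u x - partial_deriv i t x\<bar> \<le> \<bar>f x\<bar> * \<delta>"
          "\<bar>g x\<bar> * \<bar>u x - t x\<bar> \<le> \<bar>g x\<bar> * \<delta>"
        by (auto intro!: mult_left_mono)
      then show "\<bar>?d x\<bar> \<le> \<delta> * (\<bar>f x\<bar> + \<bar>g x\<bar>)"
        using abs_triangle_ineq[of "f x * (partial_deriv i u x - partial_deriv i t x)" "g x * (u x - t x)"]
        by (simp add: abs_mult distrib_left mult.commute)
    qed (use d_int absfg in \<open>auto intro!: set_integrable_abs set_integrable_mult_right\<close>)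
    also have "\<dots> = \<delta> * C" by (simp add: C_def)
    finally show ?thesis .
  qed
  have "E = 0"
  proof (rule ccontr)
    assume "E \<noteq> 0"
    \<comment> \<open>This \<open>\<delta>\<close> makes the bound \<open>\<delta> * C\<close> smaller than \<open>\<bar>E\<bar>\<close>, also when \<open>C = 0\<close>.\<close>
    then have "\<bar>E\<bar> \<le> \<bar>E\<bar> / (C + 1) * C" using \<open>C \<ge> 0\<close> by (intro E_bound) simp
    then have "\<bar>E\<bar> * (C + 1) \<le> \<bar>E\<bar> * C" using \<open>C \<ge> 0\<close> by (simp add: field_simps)
    then show False using \<open>E \<noteq> 0\<close> by (simp add: distrib_left)
  qed
  then show ?thesis by (simp add: E_def)
qed

section \<open>The integral of the norm as a supremum over \<open>C\<^sup>1\<close> fields\<close>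

text \<open>
The components are approximated separately by test functions, which may exceed the norm bound by
\<open>s\<close>. Division by \<open>1 + s\<close> restores the bound at the cost of a second error of size at most \<open>s\<close>.
\<close>

lemma C1c_fields_dense:
  fixes \<psi> :: "real ^ 'n::finite \<Rightarrow> real ^ 'm::finite"
  assumes \<Omega>: "open \<Omega>" and K: "compact K" "K \<subseteq> \<Omega>" "\<And>x. x \<notin> K \<Longrightarrow> \<psi> x = 0"
    and \<psi>: "continuous_on UNIV \<psi>" "\<And>x. norm (\<psi> x) \<le> 1" and "0 < \<delta>"
  obtains \<phi> where "\<phi> \<in> C1c_fields \<Omega>" "\<And>x. norm (\<phi> x) \<le> 1" "\<And>x. norm (\<phi> x - \<psi> x) \<le> \<delta>"
proof -
  \<comment> \<open>The approximation and the rescaling each cost \<open>s\<close>; the norm is at most the sum of the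
      \<open>CARD('m)\<close> component errors \<open>c\<close>.\<close>
  define s where "s = \<delta> / 2"
  define c where "c = s / CARD('m)"
  have "0 < s" "0 < c" using \<open>0 < \<delta>\<close> by (auto simp: s_def c_def)
  have "\<exists>t. t \<in> test_functions \<Omega> \<and> (\<forall>x. \<bar>t x - \<psi> x $ j\<bar> \<le> c)" for j
  proof -
    have "continuous_on UNIV (\<lambda>x. \<psi> x $ j)" using \<psi>(1) by (intro continuous_intros)
    from test_functions_dense_C1[OF \<Omega> K(1,2) this _ \<open>0 < c\<close>] K(3)
    show ?thesis by (metis zero_index)
  qed
  then obtain t where t: "\<And>j. t j \<in> test_functions \<Omega>" "\<And>j x. \<bar>t j x - \<psi> x $ j\<bar> \<le> c"
    by metis
  define T where "T x = (\<chi> j. t j x)" for x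
  have close: "norm (T x - \<psi> x) \<le> s" for x
  proof -
    have "norm (T x - \<psi> x) \<le> (\<Sum>j\<in>UNIV. \<bar>(T x - \<psi> x) $ j\<bar>)" by (rule norm_le_l1_cart)
    also have "\<dots> \<le> (\<Sum>j\<in>(UNIV :: 'm set). c)" by (intro sum_mono) (simp add: T_def t(2))
    also have "\<dots> = s" by (simp add: c_def)
    finally show ?thesis .
  qed
  define \<phi> where "\<phi> x = inverse (1 + s) *\<^sub>R T x" for x
  have T_le: "norm (T x) \<le> 1 + s" for x
    using close[of x] \<psi>(2)[of x] norm_triangle_ineq2[of "T x" "\<psi> x"] by linarith
  have norm_\<phi>: "norm (\<phi> x) \<le> 1" for x
    using T_le[of x] \<open>0 < s\<close> by (simp add: \<phi>_def field_simps)
  have "norm (\<phi> x - \<psi> x) \<le> \<delta>" for x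
  proof -
    have "T x - \<phi> x = s *\<^sub>R \<phi> x"
    proof -
      have "T x = (1 + s) *\<^sub>R \<phi> x" using \<open>0 < s\<close> by (simp add: \<phi>_def)
      then show ?thesis by (simp add: algebra_simps)
    qed
    then have "norm (T x - \<phi> x) \<le> s"
      using norm_\<phi>[of x] \<open>0 < s\<close> mult_left_mono[of "norm (\<phi> x)" 1 s] by simp
    then show ?thesis
      using close[of x] norm_triangle_ineq4[of "T x - \<psi> x" "T x - \<phi> x"] by (simp add: s_def)
  qed
  moreover have "\<phi> \<in> C1c_fields \<Omega>"
  proof -
    have t': "Ck_on 1 \<Omega> (t j)" "compactly_supported_in \<Omega> (t j)" for j
      using t(1)[of j] by (auto simp: test_functions_def)
    have "\<exists>K. compact K \<and> K \<subseteq> \<Omega> \<and> (\<forall>x\<in>\<Omega>-K. t j x = 0)" for j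
      using compactly_supported_inE[OF t'(2)] by metis
    then obtain L where L: "\<And>j. compact (L j)" "\<And>j. L j \<subseteq> \<Omega>" "\<And>j x. x \<in> \<Omega> - L j \<Longrightarrow> t j x = 0"
      by metis
    have "compactly_supported_in \<Omega> \<phi>"
      by (rule compactly_supported_inI[of "\<Union>j. L j"])
         (use L in \<open>auto simp: \<phi>_def T_def vec_eq_iff intro!: compact_UN\<close>)
    moreover have "Ck_on 1 \<Omega> (\<lambda>x. \<phi> x $ j)" for j
    proof -
      have "partial_deriv i (\<lambda>x. \<phi> x $ j) x = inverse (1 + s) * partial_deriv i (t j) x"
        if "x \<in> \<Omega>" for i x
        using partial_deriv_mult[of "\<lambda>x. inverse (1 + s)" x "t j" i] t'(1)[of j] that
        by (simp add: \<phi>_def T_def partial_deriv_const)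
      moreover have "continuous_on \<Omega> (\<lambda>x. inverse (1 + s) * partial_deriv i (t j) x)" for i
        using t'(1)[of j] by (intro continuous_intros) simp
      ultimately have "continuous_on \<Omega> (partial_deriv i (\<lambda>x. \<phi> x $ j))" for i
        by (simp cong: continuous_on_cong)
      moreover have "(\<lambda>x. \<phi> x $ j) differentiable (at x)" if "x \<in> \<Omega>" for x
        using t'(1)[of j] that by (simp add: \<phi>_def T_def)
      ultimately show ?thesis by simp
    qed
    ultimately show ?thesis by (simp add: C1c_fields_def)
  qed
  ultimately show ?thesis using norm_\<phi> that by blast
qed

lemma set_integrable_inner_bounded:
  fixes w G :: "real ^ 'n::finite \<Rightarrow> real ^ 'm::finite"
  assumes "open \<Omega>" "continuous_on \<Omega> w" "\<And>x. x \<in> \<Omega> \<Longrightarrow> norm (w x) \<le> B" "set_integrable lebesgue \<Omega> G"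
  shows "set_integrable lebesgue \<Omega> (\<lambda>x. w x \<bullet> G x)"
proof (rule set_integrable_bounded_product[OF assms(1,2) _ assms(4)])
  show "bounded (w ` \<Omega>)" using assms(3) by (auto simp: bounded_iff)
  show "bilinear (inner :: real ^ 'm \<Rightarrow> real ^ 'm \<Rightarrow> real)"
    by (simp add: bilinear_conv_bounded_bilinear bounded_bilinear_inner)
qed

text \<open>
Urysohn functions between consecutive members of an exhaustion of \<open>\<Omega>\<close> by compact sets.
\<close>

lemma exists_cutoff_sequence:
  fixes \<Omega> :: "'a::euclidean_space set"
  assumes "open \<Omega>"
  shows "\<exists>\<zeta> :: nat \<Rightarrow> 'a \<Rightarrow> real. (\<forall>n. continuous_on UNIV (\<zeta> n)) \<and> (\<forall>n x. 0 \<le> \<zeta> n x \<and> \<zeta> n x \<le> 1) \<and>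
    (\<forall>n. \<exists>K. compact K \<and> K \<subseteq> \<Omega> \<and> (\<forall>x. x \<notin> K \<longrightarrow> \<zeta> n x = 0)) \<and>
    (\<forall>x\<in>\<Omega>. (\<lambda>n. \<zeta> n x) \<longlonglongrightarrow> 1)"
proof -
  obtain C where C: "\<And>n. compact (C n)" "\<And>n. C n \<subseteq> \<Omega>" "\<And>n. C n \<subseteq> interior (C (Suc n))"
      "\<And>K. \<lbrakk>compact K; K \<subseteq> \<Omega>\<rbrakk> \<Longrightarrow> \<exists>N. \<forall>n\<ge>N. K \<subseteq> C n"
    using open_Union_compact_subsets[OF assms] by metis
  have "\<exists>f::'a \<Rightarrow> real. continuous_on UNIV f \<and> (\<forall>x. f x \<in> closed_segment 1 0) \<and>
      (\<forall>x\<in>C n. f x = 1) \<and> (\<forall>x\<in>- interior (C (Suc n)). f x = 0)" for n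
  proof -
    have "C n \<inter> - interior (C (Suc n)) = {}" using C(3)[of n] by auto
    from Urysohn[OF compact_imp_closed[OF C(1)] _ this, of 1 "0::real"]
    show ?thesis by (metis closed_Compl open_interior)
  qed
  then obtain \<zeta> :: "nat \<Rightarrow> 'a \<Rightarrow> real" where \<zeta>: "\<And>n. continuous_on UNIV (\<zeta> n)"
      "\<And>n x. \<zeta> n x \<in> closed_segment 1 0" "\<And>n x. x \<in> C n \<Longrightarrow> \<zeta> n x = 1"
      "\<And>n x. x \<in> - interior (C (Suc n)) \<Longrightarrow> \<zeta> n x = 0"
    by metis
  have "0 \<le> \<zeta> n x \<and> \<zeta> n x \<le> 1" for n x
    using \<zeta>(2)[of n x] by (simp add: closed_segment_eq_real_ivl)
  moreover have "\<exists>K. compact K \<and> K \<subseteq> \<Omega> \<and> (\<forall>x. x \<notin> K \<longrightarrow> \<zeta> n x = 0)" for n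
    using C(1,2)[of "Suc n"] \<zeta>(4)[of _ n] interior_subset[of "C (Suc n)"]
    by (intro exI[of _ "C (Suc n)"]) auto
  moreover have "(\<lambda>n. \<zeta> n x) \<longlonglongrightarrow> 1" if x: "x \<in> \<Omega>" for x
  proof -
    obtain N where "\<forall>n\<ge>N. {x} \<subseteq> C n" using C(4)[of "{x}"] x by auto
    then have "\<forall>\<^sub>F n in sequentially. 1 = \<zeta> n x"
      using \<zeta>(3) by (auto simp: eventually_sequentially)
    then show ?thesis by (rule Lim_transform_eventually[OF tendsto_const])
  qed
  ultimately show ?thesis using \<zeta>(1) by (intro exI[of _ \<zeta>]) simp
qed

text \<open>
The ideal field is \<open>sgn G\<close>, for which the inner product with \<open>G\<close> is \<open>norm G\<close>. It is measurable, hence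
almost everywhere the limit of continuous functions \<open>g n\<close>. Truncating these to the unit ball and
multiplying by cutoff functions keeps the limit, since \<open>sgn G\<close> has norm at most \<open>1\<close>, and yields
continuous fields \<open>\<psi> n\<close> with compact support. Dominated convergence, with \<open>norm G\<close> as majorant, shows
that one of them nearly attains the integral of the norm; a uniformly close \<open>C\<^sup>1\<close> field then does.
\<close>

lemma integral_norm_approx:
  fixes G :: "real ^ 'n::finite \<Rightarrow> real ^ 'm::finite"
  assumes \<Omega>: "open \<Omega>" and G: "set_integrable lebesgue \<Omega> G" and "0 < e"
  obtains \<phi> where "\<phi> \<in> C1c_fields \<Omega>" "\<And>x. norm (\<phi> x) \<le> 1"
    "(LINT x:\<Omega>|lebesgue. norm (G x)) - e \<le> (LINT x:\<Omega>|lebesgue. \<phi> x \<bullet> G x)"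
proof -
  have normG: "set_integrable lebesgue \<Omega> (\<lambda>x. norm (G x))" using G by (rule set_integrable_norm)
  define I where "I = (LINT x:\<Omega>|lebesgue. norm (G x))"
  have "I \<ge> 0" unfolding I_def by (simp add: set_lebesgue_integral_def)
  define H where "H x = indicator \<Omega> x *\<^sub>R G x" for x
  have H: "integrable lebesgue H" using G by (simp add: H_def[abs_def] set_integrable_def)
  have "(\<lambda>x. sgn (H x)) \<in> borel_measurable lebesgue"
    using borel_measurable_integrable[OF H] by measurable
  then have "(\<lambda>x. sgn (H x)) measurable_on UNIV"
    by (rule lebesgue_measurable_imp_measurable_on) simp
  then obtain N g where N: "negligible N" and g: "\<And>n. continuous_on UNIV (g n)"
      "\<And>x. x \<notin> N \<Longrightarrow> (\<lambda>n. g n x) \<longlonglongrightarrow> sgn (H x)"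
    by (auto simp: measurable_on_def)
  obtain \<zeta> :: "nat \<Rightarrow> real^'n \<Rightarrow> real" where \<zeta>: "\<forall>n. continuous_on UNIV (\<zeta> n)"
      "\<forall>n x. 0 \<le> \<zeta> n x \<and> \<zeta> n x \<le> 1"
      "\<forall>n. \<exists>K. compact K \<and> K \<subseteq> \<Omega> \<and> (\<forall>x. x \<notin> K \<longrightarrow> \<zeta> n x = 0)"
      "\<forall>x\<in>\<Omega>. (\<lambda>n. \<zeta> n x) \<longlonglongrightarrow> 1"
    using exists_cutoff_sequence[OF \<Omega>] by (elim exE conjE) (rule that)
  define \<psi> where "\<psi> n x = (\<zeta> n x / max 1 (norm (g n x))) *\<^sub>R g n x" for n x
  have \<psi>_cont: "continuous_on UNIV (\<psi> n)" for n
    unfolding \<psi>_def by (intro continuous_intros \<zeta>(1)[rule_format] g) (auto simp: max_def)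
  have \<psi>_norm: "norm (\<psi> n x) \<le> 1" for n x
  proof -
    have "norm (\<psi> n x) = \<zeta> n x * (norm (g n x) / max 1 (norm (g n x)))"
      using \<zeta>(2) by (simp add: \<psi>_def)
    also have "\<dots> \<le> 1 * 1" using \<zeta>(2) by (intro mult_mono) (auto simp: divide_simps)
    finally show ?thesis by simp
  qed
  have lim: "(\<lambda>n. \<psi> n x \<bullet> H x) \<longlonglongrightarrow> norm (H x)" if "x \<notin> N" for x
  proof (cases "x \<in> \<Omega>")
    case True
    have "max 1 (norm (sgn (H x))) = 1" by (simp add: norm_sgn)
    moreover have "(\<lambda>n. \<psi> n x \<bullet> H x) \<longlonglongrightarrow> ((1 / max 1 (norm (sgn (H x)))) *\<^sub>R sgn (H x)) \<bullet> H x"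
      unfolding \<psi>_def by (intro tendsto_intros \<zeta>(4)[rule_format] g(2) True that) (auto simp: max_def)
    moreover have "sgn (H x) \<bullet> H x = norm (H x)"
      by (cases "H x = 0") (simp_all add: sgn_div_norm dot_square_norm power2_eq_square)
    ultimately show ?thesis by simp
  qed (simp add: H_def)
  have "(\<lambda>n. LINT x|lebesgue. \<psi> n x \<bullet> H x) \<longlonglongrightarrow> (LINT x|lebesgue. norm (H x))"
  proof (rule integral_dominated_convergence)
    show "(\<lambda>x. norm (H x)) \<in> borel_measurable lebesgue" using H by auto
    show "(\<lambda>x. \<psi> n x \<bullet> H x) \<in> borel_measurable lebesgue" for n
      using borel_measurable_continuous_onI[OF \<psi>_cont] borel_measurable_integrable[OF H]
      by (intro borel_measurable_inner) (auto intro: measurable_completion)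
    show "integrable lebesgue (\<lambda>x. norm (H x))" using H by auto
    show "AE x in lebesgue. (\<lambda>n. \<psi> n x \<bullet> H x) \<longlonglongrightarrow> norm (H x)"
      using N lim by (auto intro!: AE_I'[of N] simp: negligible_iff_null_sets)
    show "AE x in lebesgue. norm (\<psi> n x \<bullet> H x) \<le> norm (H x)" for n
    proof (rule AE_I2)
      fix x
      have "norm (\<psi> n x \<bullet> H x) \<le> norm (\<psi> n x) * norm (H x)" by (simp add: Cauchy_Schwarz_ineq2)
      also have "\<dots> \<le> 1 * norm (H x)" by (intro mult_right_mono \<psi>_norm) simp
      finally show "norm (\<psi> n x \<bullet> H x) \<le> norm (H x)" by simp
    qed
  qed
  then have "(\<lambda>n. LINT x:\<Omega>|lebesgue. \<psi> n x \<bullet> G x) \<longlonglongrightarrow> I"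
    by (simp add: H_def I_def set_lebesgue_integral_def)
  then have "\<forall>\<^sub>F n in sequentially. I - e / 2 < (LINT x:\<Omega>|lebesgue. \<psi> n x \<bullet> G x)"
    using \<open>0 < e\<close> by (intro order_tendstoD) auto
  then obtain n where n: "I - e / 2 < (LINT x:\<Omega>|lebesgue. \<psi> n x \<bullet> G x)"
    by (auto simp: eventually_sequentially)
  \<comment> \<open>A uniform error \<open>\<delta>\<close> changes the integral by at most \<open>\<delta> * I\<close>; the summand \<open>1\<close> covers \<open>I = 0\<close>.\<close>
  define \<delta> where "\<delta> = e / (2 * (I + 1))"
  have "0 < \<delta>" using \<open>0 < e\<close> \<open>I \<ge> 0\<close> by (simp add: \<delta>_def)
  obtain K where K: "compact K" "K \<subseteq> \<Omega>" "\<And>x. x \<notin> K \<Longrightarrow> \<zeta> n x = 0" using \<zeta>(3) by metis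
  have \<psi>_off: "\<psi> n x = 0" if "x \<notin> K" for x using K(3)[OF that] by (simp add: \<psi>_def)
  obtain \<phi> where \<phi>: "\<phi> \<in> C1c_fields \<Omega>" "\<And>x. norm (\<phi> x) \<le> 1" "\<And>x. norm (\<phi> x - \<psi> n x) \<le> \<delta>"
    using C1c_fields_dense[OF \<Omega> K(1,2) \<psi>_off \<psi>_cont \<psi>_norm \<open>0 < \<delta>\<close>] by blast
  have "continuous_on \<Omega> \<phi>"
  proof -
    have "continuous_on \<Omega> (\<lambda>x. \<phi> x $ j)" for j
      using \<phi>(1) Ck_on_continuous[of 1 \<Omega> "\<lambda>x. \<phi> x $ j"] by (auto simp: C1c_fields_def simp del: One_nat_def)
    then have "continuous_on \<Omega> (\<lambda>x. \<chi> j. \<phi> x $ j)" by (rule continuous_on_vec_lambda)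
    then show ?thesis by simp
  qed
  then have int: "set_integrable lebesgue \<Omega> (\<lambda>x. \<phi> x \<bullet> G x)" "set_integrable lebesgue \<Omega> (\<lambda>x. \<psi> n x \<bullet> G x)"
    using \<phi>(2) \<psi>_norm G \<Omega> continuous_on_subset[OF \<psi>_cont]
    by (auto intro!: set_integrable_inner_bounded[of _ _ 1])
  have "(LINT x:\<Omega>|lebesgue. \<psi> n x \<bullet> G x) - (LINT x:\<Omega>|lebesgue. \<phi> x \<bullet> G x)
      = (LINT x:\<Omega>|lebesgue. \<psi> n x \<bullet> G x - \<phi> x \<bullet> G x)"
    using int by (simp add: set_integral_diff)
  also have "\<dots> \<le> (LINT x:\<Omega>|lebesgue. \<delta> * norm (G x))"
  proof (rule set_integral_mono)
    fix x
    have "\<psi> n x \<bullet> G x - \<phi> x \<bullet> G x = (\<psi> n x - \<phi> x) \<bullet> G x" by (simp add: inner_diff_left)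
    also have "\<dots> \<le> norm (\<psi> n x - \<phi> x) * norm (G x)" by (rule norm_cauchy_schwarz)
    also have "\<dots> \<le> \<delta> * norm (G x)"
      using \<phi>(3)[of x] by (intro mult_right_mono) (auto simp: norm_minus_commute)
    finally show "\<psi> n x \<bullet> G x - \<phi> x \<bullet> G x \<le> \<delta> * norm (G x)" .
  qed (use int normG in \<open>auto intro!: set_integral_diff set_integrable_mult_right\<close>)
  also have "\<dots> = \<delta> * I" by (simp add: I_def)
  also have "\<dots> \<le> e / 2" using \<open>0 < e\<close> \<open>I \<ge> 0\<close> by (simp add: \<delta>_def field_simps)
  finally show ?thesis using n \<phi>(1,2) that[of \<phi>] by (simp add: I_def)
qed

text \<open>
Duality between \<open>L\<^sup>1\<close> and bounded fields: the upper bound is the Cauchy-Schwarz inequality, the lower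
bound is \<open>integral_norm_approx\<close>.
\<close>

theorem SUP_integral_inner_eq_integral_norm:
  fixes G :: "real ^ 'n::finite \<Rightarrow> real ^ 'm::finite"
  assumes \<Omega>: "open \<Omega>" and G: "set_integrable lebesgue \<Omega> G"
  shows "(SUP \<phi>\<in>{\<phi> \<in> C1c_fields \<Omega>. \<forall>x\<in>\<Omega>. norm (\<phi> x) \<le> 1}. ereal (LINT x:\<Omega>|lebesgue. \<phi> x \<bullet> G x))
    = ereal (LINT x:\<Omega>|lebesgue. norm (G x))" (is "(SUP \<phi>\<in>?F. ereal (?J \<phi>)) = ereal ?I")
proof (rule antisym)
  show "(SUP \<phi>\<in>?F. ereal (?J \<phi>)) \<le> ereal ?I"
  proof (rule SUP_least)
    fix \<phi> assume \<phi>: "\<phi> \<in> ?F"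
    have "?J \<phi> \<le> ?I"
    proof (cases "set_integrable lebesgue \<Omega> (\<lambda>x. \<phi> x \<bullet> G x)")
      case True
      then show ?thesis
      proof (rule set_integral_mono[OF _ set_integrable_norm[OF G]])
        fix x assume "x \<in> \<Omega>"
        then have "norm (\<phi> x) * norm (G x) \<le> 1 * norm (G x)" using \<phi> by (intro mult_right_mono) auto
        then show "\<phi> x \<bullet> G x \<le> norm (G x)" using norm_cauchy_schwarz[of "\<phi> x" "G x"] by simp
      qed
    next
      case False
      \<comment> \<open>The integral of a function that is not integrable is \<open>0\<close> by convention.\<close>
      then have "?J \<phi> = 0"
        unfolding set_integrable_def set_lebesgue_integral_def by (rule not_integrable_integral_eq)
      moreover have "0 \<le> ?I" by (simp add: set_lebesgue_integral_def)
      ultimately show ?thesis by simp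
    qed
    then show "ereal (?J \<phi>) \<le> ereal ?I" by simp
  qed
  show "ereal ?I \<le> (SUP \<phi>\<in>?F. ereal (?J \<phi>))"
  proof (rule ereal_le_epsilon2)
    fix e :: real assume "0 < e"
    obtain \<phi> where \<phi>: "\<phi> \<in> C1c_fields \<Omega>" "\<And>x. norm (\<phi> x) \<le> 1" "?I - e \<le> ?J \<phi>"
      using integral_norm_approx[OF \<Omega> G \<open>0 < e\<close>] by blast
    then have "ereal (?J \<phi>) \<le> (SUP \<phi>\<in>?F. ereal (?J \<phi>))" by (intro SUP_upper) auto
    moreover have "ereal ?I \<le> ereal (?J \<phi>) + ereal e" using \<phi>(3) by simp
    ultimately show "ereal ?I \<le> (SUP \<phi>\<in>?F. ereal (?J \<phi>)) + ereal e"
      by (meson add_right_mono order_trans)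
  qed
qed

section \<open>The Hermite variation of a Sobolev function\<close>

text \<open>
Away from the origin all factors are continuous. At the origin the power may be singular, but the
coefficient is bounded by \<open>sqrt (\<alpha> - 1)\<close> times \<open>norm x\<close> to the positive power \<open>\<alpha> / 2\<close>.
\<close>

lemma continuous_on_hermite_coeff:
  assumes "\<alpha> \<ge> 1"
  shows "continuous_on S (hermite_coeff \<alpha> i)"
proof (rule continuous_at_imp_continuous_on, intro ballI)
  fix x :: "real ^ 'a"
  show "isCont (hermite_coeff \<alpha> i) x"
  proof (cases "x = 0")
    case False
    then show ?thesis
      unfolding hermite_coeff_def[abs_def] by (intro continuous_intros) auto
  next
    case True
    have "(hermite_coeff \<alpha> i \<longlongrightarrow> 0) (at (0::real ^ 'a))"
    proof (rule Lim_null_comparison)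
      show "\<forall>\<^sub>F y in at (0::real ^ 'a). norm (hermite_coeff \<alpha> i y) \<le> sqrt (\<alpha> - 1) * norm y powr (\<alpha> / 2)"
      proof (rule always_eventually, intro allI)
        fix y :: "real ^ 'a"
        have "norm (hermite_coeff \<alpha> i y) = sqrt (\<alpha> - 1) * (\<bar>y $ i\<bar> * norm y powr ((\<alpha> - 2) / 2))"
          using assms by (simp add: hermite_coeff_def abs_mult)
        also have "\<dots> \<le> sqrt (\<alpha> - 1) * (norm y * norm y powr ((\<alpha> - 2) / 2))"
          using assms by (intro mult_left_mono mult_right_mono component_le_norm_cart) auto
        also have "norm y * norm y powr ((\<alpha> - 2) / 2) = norm y powr (1 + (\<alpha> - 2) / 2)"
          by (simp add: powr_mult_base)
        also have "1 + (\<alpha> - 2) / 2 = \<alpha> / 2" by (simp add: field_simps)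
        finally show "norm (hermite_coeff \<alpha> i y) \<le> sqrt (\<alpha> - 1) * norm y powr (\<alpha> / 2)" .
      qed
      have "((\<lambda>y::real ^ 'a. sqrt (\<alpha> - 1) * norm y powr (\<alpha> / 2)) \<longlongrightarrow> sqrt (\<alpha> - 1) * (norm (0::real ^ 'a) powr (\<alpha> / 2))) (at 0)"
        using assms by (intro tendsto_intros tendsto_powr') auto
      then show "((\<lambda>y::real ^ 'a. sqrt (\<alpha> - 1) * norm y powr (\<alpha> / 2)) \<longlongrightarrow> 0) (at 0)" by simp
    qed
    then show ?thesis using True by (simp add: isCont_def hermite_coeff_def)
  qed
qed

lemma C1c_fields_component:
  fixes \<phi> :: "real ^ 'n::finite \<Rightarrow> real ^ 'm::finite"
  assumes "\<phi> \<in> C1c_fields \<Omega>"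
  shows "Ck_on 1 \<Omega> (\<lambda>x. \<phi> x $ j)" "compactly_supported_in \<Omega> (\<lambda>x. \<phi> x $ j)"
proof -
  show "Ck_on 1 \<Omega> (\<lambda>x. \<phi> x $ j)" using assms unfolding C1c_fields_def by blast
  have "compactly_supported_in \<Omega> \<phi>" using assms by (simp add: C1c_fields_def)
  then obtain K where "compact K" "K \<subseteq> \<Omega>" "\<And>x. x \<in> \<Omega> - K \<Longrightarrow> \<phi> x = 0"
    by (rule compactly_supported_inE) blast
  then show "compactly_supported_in \<Omega> (\<lambda>x. \<phi> x $ j)" by (intro compactly_supported_inI[of K]) auto
qed

lemma set_integrable_hermite_coeff_mult:
  fixes f u :: "real ^ 'n::finite \<Rightarrow> real"
  assumes "\<alpha> \<ge> 1" "open \<Omega>" "set_integrable lebesgue \<Omega> f" "Ck_on 1 \<Omega> u" "compactly_supported_in \<Omega> u"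
  shows "set_integrable lebesgue \<Omega> (\<lambda>x. f x * (hermite_coeff \<alpha> i x * u x))"
proof -
  obtain K where K: "compact K" "K \<subseteq> \<Omega>" "\<And>x. x \<in> \<Omega> - K \<Longrightarrow> u x = 0"
    using assms(5) by (rule compactly_supported_inE) blast
  have "continuous_on \<Omega> (\<lambda>x. hermite_coeff \<alpha> i x * u x)"
    by (intro continuous_intros continuous_on_hermite_coeff Ck_on_continuous[OF assms(4)] assms(1))
  then show ?thesis
    by (intro set_integrable_mult_bounded assms bounded_image_compact_support[OF _ K(1,2)])
       (use K(3) in auto)
qed

text \<open>
Integration by parts moves the derivative to \<open>f\<close> and changes its sign, while the multiplication term
keeps its sign. This exchanges \<open>A\<^sup>+\<close> and \<open>A\<^sup>-\<close>.
\<close>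

lemma integral_A_plus_A_minus:
  fixes f u :: "real ^ 'n::finite \<Rightarrow> real"
  assumes \<alpha>: "\<alpha> \<ge> 1" and \<Omega>: "open \<Omega>" and f: "set_integrable lebesgue \<Omega> f"
    and g: "set_integrable lebesgue \<Omega> (weak_partial \<Omega> i f)"
    and weak: "is_weak_partial \<Omega> i f (weak_partial \<Omega> i f)"
    and u: "Ck_on 1 \<Omega> u" "compactly_supported_in \<Omega> u"
  shows "set_integrable lebesgue \<Omega> (\<lambda>x. f x * A_plus \<alpha> i u x)"
    and "set_integrable lebesgue \<Omega> (\<lambda>x. weak_A_minus \<alpha> \<Omega> i f x * u x)"
    and "(LINT x:\<Omega>|lebesgue. f x * A_plus \<alpha> i u x) = - (LINT x:\<Omega>|lebesgue. weak_A_minus \<alpha> \<Omega> i f x * u x)"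
    and "set_integrable lebesgue \<Omega> (\<lambda>x. f x * A_minus \<alpha> i u x)"
    and "set_integrable lebesgue \<Omega> (\<lambda>x. weak_A_plus \<alpha> \<Omega> i f x * u x)"
    and "(LINT x:\<Omega>|lebesgue. f x * A_minus \<alpha> i u x) = - (LINT x:\<Omega>|lebesgue. weak_A_plus \<alpha> \<Omega> i f x * u x)"
proof -
  let ?g = "weak_partial \<Omega> i f"
  have int: "set_integrable lebesgue \<Omega> (\<lambda>x. f x * partial_deriv i u x)"
      "set_integrable lebesgue \<Omega> (\<lambda>x. ?g x * u x)"
      "set_integrable lebesgue \<Omega> (\<lambda>x. f x * (hermite_coeff \<alpha> i x * u x))"
    by (intro C1c_integrable[OF \<Omega> u] set_integrable_hermite_coeff_mult[OF \<alpha> \<Omega> _ u] f g)+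
  have eq: "(LINT x:\<Omega>|lebesgue. f x * partial_deriv i u x) = - (LINT x:\<Omega>|lebesgue. ?g x * u x)"
    by (rule weak_partial_C1[OF \<Omega> f g weak u])
  have A: "f x * A_plus \<alpha> i u x = f x * partial_deriv i u x + f x * (hermite_coeff \<alpha> i x * u x)"
      "f x * A_minus \<alpha> i u x = f x * partial_deriv i u x - f x * (hermite_coeff \<alpha> i x * u x)"
      "weak_A_plus \<alpha> \<Omega> i f x * u x = ?g x * u x + f x * (hermite_coeff \<alpha> i x * u x)"
      "weak_A_minus \<alpha> \<Omega> i f x * u x = ?g x * u x - f x * (hermite_coeff \<alpha> i x * u x)" for x
    by (simp_all add: A_plus_def A_minus_def weak_A_plus_def weak_A_minus_def algebra_simps)
  show "set_integrable lebesgue \<Omega> (\<lambda>x. f x * A_plus \<alpha> i u x)"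
    "set_integrable lebesgue \<Omega> (\<lambda>x. f x * A_minus \<alpha> i u x)"
    "set_integrable lebesgue \<Omega> (\<lambda>x. weak_A_plus \<alpha> \<Omega> i f x * u x)"
    "set_integrable lebesgue \<Omega> (\<lambda>x. weak_A_minus \<alpha> \<Omega> i f x * u x)"
    unfolding A using int by (simp_all add: set_integral_add set_integral_diff)
  show "(LINT x:\<Omega>|lebesgue. f x * A_plus \<alpha> i u x) = - (LINT x:\<Omega>|lebesgue. weak_A_minus \<alpha> \<Omega> i f x * u x)"
    "(LINT x:\<Omega>|lebesgue. f x * A_minus \<alpha> i u x) = - (LINT x:\<Omega>|lebesgue. weak_A_plus \<alpha> \<Omega> i f x * u x)"
    unfolding A using int eq by (simp_all add: set_integral_add set_integral_diff)
qed

lemma sum_UNIV_Plus: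
  fixes h :: "'a::finite + 'b::finite \<Rightarrow> 'c::comm_monoid_add"
  shows "(\<Sum>k\<in>UNIV. h k) = (\<Sum>i\<in>UNIV. h (Inl i)) + (\<Sum>i\<in>UNIV. h (Inr i))"
  using sum.Plus[of "UNIV :: 'a set" "UNIV :: 'b set" h] by (simp add: UNIV_Plus_UNIV comp_def)

text \<open>
The plain weak derivative is the mean of the two Hermite derivatives, hence it is integrable on
\<open>\<Omega>\<close> and not merely locally integrable.
\<close>

lemma W11_hermite_weak_partial:
  assumes "f \<in> W11_hermite \<alpha> \<Omega>"
  shows "set_integrable lebesgue \<Omega> f"
    and "is_weak_partial \<Omega> i f (weak_partial \<Omega> i f)"
    and "set_integrable lebesgue \<Omega> (weak_partial \<Omega> i f)"
    and "set_integrable lebesgue \<Omega> (weak_A_plus \<alpha> \<Omega> i f)"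
    and "set_integrable lebesgue \<Omega> (weak_A_minus \<alpha> \<Omega> i f)"
proof -
  show "set_integrable lebesgue \<Omega> f" and A: "set_integrable lebesgue \<Omega> (weak_A_plus \<alpha> \<Omega> i f)"
      "set_integrable lebesgue \<Omega> (weak_A_minus \<alpha> \<Omega> i f)"
    using assms by (auto simp: W11_hermite_def L1_set_def)
  have "\<exists>g. is_weak_partial \<Omega> i f g" using assms by (simp add: W11_hermite_def)
  then show "is_weak_partial \<Omega> i f (weak_partial \<Omega> i f)"
    unfolding weak_partial_def by (rule someI_ex)
  have "weak_partial \<Omega> i f = (\<lambda>x. (1 / 2) * (weak_A_plus \<alpha> \<Omega> i f x + weak_A_minus \<alpha> \<Omega> i f x))"
    by (auto simp: weak_A_plus_def weak_A_minus_def)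
  moreover have "set_integrable lebesgue \<Omega> (\<lambda>x. (1 / 2) * (weak_A_plus \<alpha> \<Omega> i f x + weak_A_minus \<alpha> \<Omega> i f x))"
    by (intro set_integrable_mult_right set_integral_add A)
  ultimately show "set_integrable lebesgue \<Omega> (weak_partial \<Omega> i f)" by simp
qed

lemma set_integrable_hermite_grad:
  assumes "f \<in> W11_hermite \<alpha> \<Omega>"
  shows "set_integrable lebesgue \<Omega> (hermite_grad \<alpha> \<Omega> f)"
proof (rule absolutely_integrable_componentwise)
  fix b :: "real ^ ('a + 'a)" assume "b \<in> Basis"
  then obtain k where "b = axis k 1" by (auto simp: Basis_vec_def)
  then have "(\<lambda>x. hermite_grad \<alpha> \<Omega> f x \<bullet> b)
      = (case k of Inl i \<Rightarrow> weak_A_minus \<alpha> \<Omega> i f | Inr i \<Rightarrow> weak_A_plus \<alpha> \<Omega> i f)"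
    by (auto simp: fun_eq_iff inner_axis hermite_grad_def split: sum.split)
  then show "set_integrable lebesgue \<Omega> (\<lambda>x. hermite_grad \<alpha> \<Omega> f x \<bullet> b)"
    using W11_hermite_weak_partial(4,5)[OF assms] by (auto split: sum.split)
qed

text \<open>
The signs in the divergence are opposite to those in the gradient, so the divergence is minus the
formal adjoint of the gradient.
\<close>

lemma integral_hermite_div:
  fixes f :: "real ^ 'n::finite \<Rightarrow> real"
  assumes \<alpha>: "\<alpha> \<ge> 1" and \<Omega>: "open \<Omega>" and f: "f \<in> W11_hermite \<alpha> \<Omega>" and \<phi>: "\<phi> \<in> C1c_fields \<Omega>"
  shows "(LINT x:\<Omega>|lebesgue. f x * hermite_div \<alpha> \<phi> x)
    = (LINT x:\<Omega>|lebesgue. \<phi> x \<bullet> (- hermite_grad \<alpha> \<Omega> f x))"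
proof -
  note parts = integral_A_plus_A_minus[OF \<alpha> \<Omega> W11_hermite_weak_partial(1,3,2)[OF f] C1c_fields_component[OF \<phi>]]
  have div: "f x * hermite_div \<alpha> \<phi> x = (\<Sum>i\<in>UNIV. f x * A_plus \<alpha> i (\<lambda>y. \<phi> y $ Inl i) x)
      + (\<Sum>i\<in>UNIV. f x * A_minus \<alpha> i (\<lambda>y. \<phi> y $ Inr i) x)" for x
    by (simp add: hermite_div_def distrib_left sum_distrib_left)
  have grad: "\<phi> x \<bullet> (- hermite_grad \<alpha> \<Omega> f x) = - ((\<Sum>i\<in>UNIV. weak_A_minus \<alpha> \<Omega> i f x * \<phi> x $ Inl i)
      + (\<Sum>i\<in>UNIV. weak_A_plus \<alpha> \<Omega> i f x * \<phi> x $ Inr i))" for x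
    by (simp add: inner_vec_def sum_UNIV_Plus hermite_grad_def sum_negf mult.commute)
  have "(LINT x:\<Omega>|lebesgue. \<phi> x \<bullet> (- hermite_grad \<alpha> \<Omega> f x))
      = - ((\<Sum>i\<in>UNIV. LINT x:\<Omega>|lebesgue. weak_A_minus \<alpha> \<Omega> i f x * \<phi> x $ Inl i)
      + (\<Sum>i\<in>UNIV. LINT x:\<Omega>|lebesgue. weak_A_plus \<alpha> \<Omega> i f x * \<phi> x $ Inr i))"
    unfolding grad
    by (subst set_integral_uminus) (simp_all add: set_integral_add set_integral_finite_sum parts)
  moreover have "(LINT x:\<Omega>|lebesgue. f x * hermite_div \<alpha> \<phi> x)
      = (\<Sum>i\<in>UNIV. LINT x:\<Omega>|lebesgue. f x * A_plus \<alpha> i (\<lambda>y. \<phi> y $ Inl i) x)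
      + (\<Sum>i\<in>UNIV. LINT x:\<Omega>|lebesgue. f x * A_minus \<alpha> i (\<lambda>y. \<phi> y $ Inr i) x)"
    unfolding div by (simp add: set_integral_add set_integral_finite_sum parts)
  ultimately show ?thesis by (simp add: parts(3,6) sum_negf)
qed

theorem hermite_variation_W11:
  fixes f :: "real ^ 'n::finite \<Rightarrow> real"
  assumes "\<alpha> \<ge> 1" "open \<Omega>" "f \<in> W11_hermite \<alpha> \<Omega>"
  shows "hermite_variation \<alpha> \<Omega> f = ereal (LINT x:\<Omega>|lebesgue. norm (hermite_grad \<alpha> \<Omega> f x))"
proof -
  have "hermite_variation \<alpha> \<Omega> f
      = (SUP \<phi>\<in>admissible_fields \<Omega>. ereal (LINT x:\<Omega>|lebesgue. \<phi> x \<bullet> (- hermite_grad \<alpha> \<Omega> f x)))"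
    unfolding hermite_variation_def
    by (intro SUP_cong refl) (simp add: admissible_fields_def integral_hermite_div[OF assms])
  also have "\<dots> = ereal (LINT x:\<Omega>|lebesgue. norm (- hermite_grad \<alpha> \<Omega> f x))"
    unfolding admissible_fields_def
    by (intro SUP_integral_inner_eq_integral_norm assms(2))
       (use set_integrable_hermite_grad[OF assms(3)] in \<open>simp add: set_integrable_def\<close>)
  finally show ?thesis by simp
qed

section \<open>Lower semicontinuity of the Hermite variation\<close>

lemma hermite_div_compact_support:
  fixes \<phi> :: "real ^ 'n::finite \<Rightarrow> real ^ ('n + 'n)"
  assumes \<alpha>: "\<alpha> \<ge> 1" and \<Omega>: "open \<Omega>" and \<phi>: "\<phi> \<in> C1c_fields \<Omega>"
  obtains K where "compact K" "K \<subseteq> \<Omega>" "continuous_on \<Omega> (hermite_div \<alpha> \<phi>)"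
    "\<And>x. x \<in> \<Omega> - K \<Longrightarrow> hermite_div \<alpha> \<phi> x = 0"
proof -
  have "compactly_supported_in \<Omega> \<phi>" using \<phi> by (simp add: C1c_fields_def)
  then obtain K where K: "compact K" "K \<subseteq> \<Omega>" "\<And>x. x \<in> \<Omega> - K \<Longrightarrow> \<phi> x = 0"
    by (rule compactly_supported_inE) blast
  have opn: "open (\<Omega> - K)" using \<Omega> K(1) by (simp add: compact_imp_closed open_Diff)
  note comp = C1c_fields_component(1)[OF \<phi>]
  have d: "continuous_on \<Omega> (partial_deriv i (\<lambda>y. \<phi> y $ j))" for i j using comp[of j] by simp
  show ?thesis
  proof (rule that[OF K(1,2)])
    show "continuous_on \<Omega> (hermite_div \<alpha> \<phi>)"
      unfolding hermite_div_def[abs_def] A_plus_def A_minus_def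
      by (intro continuous_intros d continuous_on_hermite_coeff[OF \<alpha>] Ck_on_continuous[OF comp])
    fix x assume x: "x \<in> \<Omega> - K"
    have "partial_deriv i (\<lambda>y. \<phi> y $ j) x = 0" for i j
      by (rule partial_deriv_eq_0[OF opn x]) (simp add: K(3))
    then show "hermite_div \<alpha> \<phi> x = 0"
      using K(3)[OF x] by (simp add: hermite_div_def A_plus_def A_minus_def)
  qed
qed

text \<open>
Local convergence suffices because \<open>w\<close> is bounded and vanishes outside the compact set \<open>K\<close>.
\<close>

lemma tendsto_L1loc_integral:
  fixes w f :: "real ^ 'n::finite \<Rightarrow> real"
  assumes \<Omega>: "open \<Omega>" and K: "compact K" "K \<subseteq> \<Omega>" and w: "continuous_on \<Omega> w" "\<And>x. x \<in> \<Omega> - K \<Longrightarrow> w x = 0"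
    and f: "set_integrable lebesgue \<Omega> f" and fs: "\<And>k. set_integrable lebesgue \<Omega> (fs k)"
    and lim: "tendsto_L1loc \<Omega> fs f"
  shows "(\<lambda>k. LINT x:\<Omega>|lebesgue. fs k x * w x) \<longlonglongrightarrow> (LINT x:\<Omega>|lebesgue. f x * w x)"
proof -
  have bdd: "bounded (w ` \<Omega>)" by (rule bounded_image_compact_support[OF w(1) K w(2)])
  then obtain B where B: "\<And>x. x \<in> \<Omega> \<Longrightarrow> \<bar>w x\<bar> \<le> B" by (auto simp: bounded_iff)
  note int = set_integrable_mult_bounded[OF \<Omega> w(1) bdd]
  have "\<bar>(LINT x:\<Omega>|lebesgue. fs k x * w x) - (LINT x:\<Omega>|lebesgue. f x * w x)\<bar>
      \<le> B * (LINT x:K|lebesgue. \<bar>fs k x - f x\<bar>)" for k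
  proof -
    have d: "set_integrable lebesgue \<Omega> (\<lambda>x. fs k x - f x)" by (intro set_integral_diff f fs)
    have dK: "set_integrable lebesgue K (\<lambda>x. \<bar>fs k x - f x\<bar>)"
      using d K by (intro set_integrable_abs set_integrable_subset[OF d]) (auto simp: compact_imp_closed lmeasurable_compact fmeasurableD)
    have dw: "set_integrable lebesgue \<Omega> (\<lambda>x. (fs k x - f x) * w x)" by (rule int[OF d])
    have "(LINT x:\<Omega>|lebesgue. fs k x * w x) - (LINT x:\<Omega>|lebesgue. f x * w x)
        = (LINT x:\<Omega>|lebesgue. (fs k x - f x) * w x)"
      by (simp add: left_diff_distrib set_integral_diff int f fs)
    also have "\<bar>\<dots>\<bar> \<le> (LINT x:\<Omega>|lebesgue. \<bar>(fs k x - f x) * w x\<bar>)"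
      using set_integral_norm_bound[OF dw] by simp
    also have "\<dots> \<le> (LINT x:K|lebesgue. B * \<bar>fs k x - f x\<bar>)"
      unfolding set_lebesgue_integral_def
    proof (rule integral_mono)
      show "integrable lebesgue (\<lambda>x. indicator \<Omega> x *\<^sub>R \<bar>(fs k x - f x) * w x\<bar>)"
        using set_integrable_abs[OF dw] by (simp add: set_integrable_def)
      show "integrable lebesgue (\<lambda>x. indicator K x *\<^sub>R (B * \<bar>fs k x - f x\<bar>))"
        using set_integrable_mult_right[OF dK, of B] by (simp add: set_integrable_def)
      fix x
      show "indicator \<Omega> x *\<^sub>R \<bar>(fs k x - f x) * w x\<bar> \<le> indicator K x *\<^sub>R (B * \<bar>fs k x - f x\<bar>)"
        using K(2) w(2)[of x] B[of x] mult_right_mono[of "\<bar>w x\<bar>" B "\<bar>fs k x - f x\<bar>"]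
        by (auto simp: indicator_def abs_mult mult.commute)
    qed
    also have "\<dots> = B * (LINT x:K|lebesgue. \<bar>fs k x - f x\<bar>)" by simp
    finally show ?thesis .
  qed
  then have "\<forall>\<^sub>F k in sequentially. norm ((LINT x:\<Omega>|lebesgue. fs k x * w x) - (LINT x:\<Omega>|lebesgue. f x * w x))
      \<le> B * (LINT x:K|lebesgue. \<bar>fs k x - f x\<bar>)"
    by simp
  moreover have "(\<lambda>k. B * (LINT x:K|lebesgue. \<bar>fs k x - f x\<bar>)) \<longlonglongrightarrow> 0"
    using lim K by (intro tendsto_mult_right_zero) (simp add: tendsto_L1loc_def)
  ultimately have "(\<lambda>k. (LINT x:\<Omega>|lebesgue. fs k x * w x) - (LINT x:\<Omega>|lebesgue. f x * w x)) \<longlonglongrightarrow> 0"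
    by (rule Lim_null_comparison)
  then show ?thesis by (rule LIM_zero_cancel)
qed

text \<open>
For each field the integral against its divergence is continuous for local \<open>L\<^sup>1\<close> convergence, and a
supremum of continuous functionals is lower semicontinuous.
\<close>

theorem hermite_variation_lsc:
  fixes f :: "real ^ 'n::finite \<Rightarrow> real"
  assumes "\<alpha> \<ge> 1" "open \<Omega>" "f \<in> L1_set \<Omega>" "\<And>k. fs k \<in> L1_set \<Omega>" "tendsto_L1loc \<Omega> fs f"
  shows "hermite_variation \<alpha> \<Omega> f \<le> liminf (\<lambda>k. hermite_variation \<alpha> \<Omega> (fs k))"
  unfolding hermite_variation_def[of \<alpha> \<Omega> f]
proof (rule SUP_least)
  fix \<phi> assume \<phi>: "\<phi> \<in> admissible_fields \<Omega>"
  then obtain K where K: "compact K" "K \<subseteq> \<Omega>" "continuous_on \<Omega> (hermite_div \<alpha> \<phi>)"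
      "\<And>x. x \<in> \<Omega> - K \<Longrightarrow> hermite_div \<alpha> \<phi> x = 0"
    using hermite_div_compact_support[OF assms(1,2)] by (auto simp: admissible_fields_def)
  have "(\<lambda>k. LINT x:\<Omega>|lebesgue. fs k x * hermite_div \<alpha> \<phi> x) \<longlonglongrightarrow> (LINT x:\<Omega>|lebesgue. f x * hermite_div \<alpha> \<phi> x)"
    using assms(3-5) by (intro tendsto_L1loc_integral[OF assms(2) K]) (auto simp: L1_set_def)
  then have "liminf (\<lambda>k. ereal (LINT x:\<Omega>|lebesgue. fs k x * hermite_div \<alpha> \<phi> x))
      = ereal (LINT x:\<Omega>|lebesgue. f x * hermite_div \<alpha> \<phi> x)"
    by (intro lim_imp_Liminf) auto
  moreover have "ereal (LINT x:\<Omega>|lebesgue. fs k x * hermite_div \<alpha> \<phi> x) \<le> hermite_variation \<alpha> \<Omega> (fs k)" for k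
    unfolding hermite_variation_def using \<phi> by (intro SUP_upper)
  then have "liminf (\<lambda>k. ereal (LINT x:\<Omega>|lebesgue. fs k x * hermite_div \<alpha> \<phi> x))
      \<le> liminf (\<lambda>k. hermite_variation \<alpha> \<Omega> (fs k))"
    by (intro Liminf_mono always_eventually) simp
  ultimately show "ereal (LINT x:\<Omega>|lebesgue. f x * hermite_div \<alpha> \<phi> x)
      \<le> liminf (\<lambda>k. hermite_variation \<alpha> \<Omega> (fs k))" by simp
qed

section \<open>Both properties of the variation\<close>

theorem lemma1p2:
  fixes \<Omega> :: "(real ^ 'n::finite) set" and \<alpha> :: real
  assumes "CARD('n) \<ge> 2" and "\<alpha> \<ge> 1" and "open \<Omega>"
  shows "(\<forall>f. f \<in> W11_hermite \<alpha> \<Omega> \<longrightarrow>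
            hermite_variation \<alpha> \<Omega> f = ereal (LINT x:\<Omega>|lebesgue. norm (hermite_grad \<alpha> \<Omega> f x)))
       \<and> (\<forall>f fs. f \<in> BV_hermite \<alpha> \<Omega> \<and> (\<forall>k::nat. fs k \<in> BV_hermite \<alpha> \<Omega>) \<and> tendsto_L1loc \<Omega> fs f \<longrightarrow>
            liminf (\<lambda>k. hermite_variation \<alpha> \<Omega> (fs k)) \<ge> hermite_variation \<alpha> \<Omega> f)"
  using hermite_variation_W11[OF assms(2,3)] hermite_variation_lsc[OF assms(2,3)]
  by (auto simp: BV_hermite_def)

end
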